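(* Let $F:\Omega\times I\to\Omega\times I$, $F(\omega,x)=(\tau(\omega),f_\omega(x))$, be a skew product satisfying one of the following two sets of assumptions: (A) [one-step case] $(\Omega,\mathscr F,\mathbb P)=(\mathcal A^{\mathbb N},\mathcal F^{\mathbb N},p^{\mathbb N})$ with $\tau$ the Bernoulli shift, $f_\omega=f_{\omega_0}$ depends only on $\omega_0$, and: for every $x\in(0,1)$ the sequence $X^x_n(\omega)=f^n_\omega(x)$, $n\ge1$, has trivial tail $\sigma$-algebra; for every $\omega\in\Omega$, $f_\omega:(0,1)\to(0,1)$ is a monotonically increasing measurable map; for every $x\in(0,1)$ there exist $\alpha,\beta\in\Omega$ with $f_\alpha(x)<x<f_\beta(x)$; and $F$ satisfies the pointwise-fiber fluctuation law with constants $\gamma_0<\gamma_1$; (B) $\tau$ is an ergodic measure-preserving transformation of a standard probability space $(\Omega,\mathscr F,\mathbb P)$, the $f_\omega:I\to I$ are measurable, $\mathbb P\times\mathrm{Leb}$ is ergodic with respect to $F$, and $F$ satisfies the skew-product fluctuation law with constants $\gamma_0<\gamma_1$. Suppose moreover that $f_\omega(0)=0$ and $f_\omega(1)=1$ for $\mathbb P$-a.e. $\omega\in\Omega$, and that (i) for any $0<\epsilon<1/2$, $$\lim_{n\to\infty}\frac1n\sum_{j=0}^{n-1}\mathbf 1_{[\epsilon,1-\epsilon]}(f^j_\omega(x))=0\quad\text{for }(\mathbb P\times\mathrm{Leb})\text{-a.e. }(\omega,x)\in\Omega\times I;$$ (ii) the constants $\gamma_0$ and $\gamma_1$ in the fluctuation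 law (pointwise-fiber in case (A), skew-product in case (B)) can be chosen arbitrarily close to $0$ and $1$, respectively. Then $$\mathcal L(\omega,x)=\{\lambda\delta_0+(1-\lambda)\delta_1:\lambda\in[0,1]\}\quad\text{for }(\mathbb P\times\mathrm{Leb})\text{-a.e. }(\omega,x)\in\Omega\times I.$$
   Context: $I=[0,1]$ with Lebesgue measure $\mathrm{Leb}$; $\delta_0,\delta_1$ are Dirac measures. $f^0_\omega=\mathrm{id}$ and $f^n_\omega=f_{\tau^{n-1}(\omega)}\circ\dots\circ f_\omega$. In case (A), $\mathcal A$ is an at most countable alphabet with discrete $\sigma$-algebra $\mathcal F$, $p$ is a probability on $\mathcal A$ with $p(a)>0$ for all $a$, and each $f_a:I\to I$, $a\in\mathcal A$, is measurable. Tail $\sigma$-algebra: $\mathcal T(\{X_n\}_{n\ge1})=\bigcap_{m\ge1}\sigma(X_m,X_{m+1},\dots)$; trivial means all its elements have $\mathbb P$-probability $0$ or $1$. Monotonically increasing means $x\le y\Rightarrow f_\omega(x)\le f_\omega(y)$. $\mu=\mathbb P\times\mathrm{Leb}$ (not necessarily invariant) is ergodic with respect to $F$ if $\mu(A)\in\{0,1\}$ for every measurable $A$ with $F(A)\subset A$. Let $I_0(\gamma)=[0,\gamma]$, $I_1(\gamma)=[\gamma,1]$. Pointwise-fiber fluctuation law with constants $\gamma_0,\gamma_1\in(0,1)$: there are $x_0,x_1\in(0,1)$ with $\liminf_{n\to\infty}\mathbb P\big(\frac1n\sum_{j=0}^{n-1}\mathbf 1_{I_i(\gamma_i)}(f^j_\omega(x_i))\le\alpha\big)<1$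 for every $\alpha\in(0,1)$, $i=0,1$. Skew-product fluctuation law with constants $\gamma_0,\gamma_1\in(0,1)$: $\liminf_{n\to\infty}(\mathbb P\times\mathrm{Leb})\big(\frac1n\sum_{j=0}^{n-1}\mathbf 1_{I_i(\gamma_i)}(f^j_\omega(x))\le\alpha\big)<1$ for every $\alpha\in(0,1)$, $i=0,1$. That the constants can be chosen arbitrarily close to $0$ and $1$ means: for every $\eta\in(0,1/2)$ the law holds for some $\gamma_0\in(0,\eta)$ and $\gamma_1\in(1-\eta,1)$ (in the pointwise-fiber law the points $x_0,x_1$ may depend on the constants). $\mathcal L(\omega,x)$ is the set of accumulation points, in the weak$^*$ topology, of the empirical measures $e_n(\omega,x)=\frac1n\sum_{j=0}^{n-1}\delta_{f^j_\omega(x)}$, $n\ge1$. *)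

theory Defs
  imports "HOL-Probability.Probability"
begin

section \<open>Skew products over the unit interval\<close>

abbreviation unit_borel :: "real measure" where
  "unit_borel \<equiv> restrict_space borel {0..1}"

abbreviation unit_leb :: "real measure" where
  "unit_leb \<equiv> restrict_space lborel {0..1}"

definition skew :: "('w \<Rightarrow> 'w) \<Rightarrow> ('w \<Rightarrow> real \<Rightarrow> real) \<Rightarrow> 'w \<times> real \<Rightarrow> 'w \<times> real" where
  "skew T f = (\<lambda>(\<omega>, x). (T \<omega>, f \<omega> x))"

primrec fiber_iter :: "('w \<Rightarrow> 'w) \<Rightarrow> ('w \<Rightarrow> real \<Rightarrow> real) \<Rightarrow> nat \<Rightarrow> 'w \<Rightarrow> real \<Rightarrow> real" where
  "fiber_iter T f 0 \<omega> x = x"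
| "fiber_iter T f (Suc n) \<omega> x = f ((T ^^ n) \<omega>) (fiber_iter T f n \<omega> x)"

lemma skew_funpow: "(skew T f ^^ n) (\<omega>, x) = ((T ^^ n) \<omega>, fiber_iter T f n \<omega> x)"
  by (induction n) (auto simp: skew_def)

definition visit_freq ::
  "('w \<Rightarrow> 'w) \<Rightarrow> ('w \<Rightarrow> real \<Rightarrow> real) \<Rightarrow> real set \<Rightarrow> nat \<Rightarrow> 'w \<Rightarrow> real \<Rightarrow> real" where
  "visit_freq T f S n \<omega> x = (\<Sum>j<n. indicator S (fiber_iter T f j \<omega> x)) / real n"

section \<open>Fluctuation laws\<close>

definition pointwise_fiber_law ::
  "'w measure \<Rightarrow> ('w \<Rightarrow> 'w) \<Rightarrow> ('w \<Rightarrow> real \<Rightarrow> real) \<Rightarrow> real \<Rightarrow> real \<Rightarrow> bool" where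
  "pointwise_fiber_law P T f \<gamma>\<^sub>0 \<gamma>\<^sub>1 \<longleftrightarrow>
     \<gamma>\<^sub>0 \<in> {0<..<1} \<and> \<gamma>\<^sub>1 \<in> {0<..<1} \<and>
     (\<exists>x\<^sub>0\<in>{0<..<1}. \<exists>x\<^sub>1\<in>{0<..<1}. \<forall>\<alpha>\<in>{0<..<1}.
        liminf (\<lambda>n. emeasure P {\<omega> \<in> space P. visit_freq T f {0..\<gamma>\<^sub>0} n \<omega> x\<^sub>0 \<le> \<alpha>}) < 1 \<and>
        liminf (\<lambda>n. emeasure P {\<omega> \<in> space P. visit_freq T f {\<gamma>\<^sub>1..1} n \<omega> x\<^sub>1 \<le> \<alpha>}) < 1)"

definition skew_product_law ::
  "'w measure \<Rightarrow> ('w \<Rightarrow> 'w) \<Rightarrow> ('w \<Rightarrow> real \<Rightarrow> real) \<Rightarrow> real \<Rightarrow> real \<Rightarrow> bool" where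
  "skew_product_law P T f \<gamma>\<^sub>0 \<gamma>\<^sub>1 \<longleftrightarrow>
     \<gamma>\<^sub>0 \<in> {0<..<1} \<and> \<gamma>\<^sub>1 \<in> {0<..<1} \<and>
     (\<forall>\<alpha>\<in>{0<..<1}.
        liminf (\<lambda>n. emeasure (P \<Otimes>\<^sub>M unit_leb)
          {(\<omega>, x) \<in> space (P \<Otimes>\<^sub>M unit_leb). visit_freq T f {0..\<gamma>\<^sub>0} n \<omega> x \<le> \<alpha>}) < 1 \<and>
        liminf (\<lambda>n. emeasure (P \<Otimes>\<^sub>M unit_leb)
          {(\<omega>, x) \<in> space (P \<Otimes>\<^sub>M unit_leb). visit_freq T f {\<gamma>\<^sub>1..1} n \<omega> x \<le> \<alpha>}) < 1)"

definition constants_arbitrarily_close :: "(real \<Rightarrow> real \<Rightarrow> bool) \<Rightarrow> bool" where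
  "constants_arbitrarily_close law \<longleftrightarrow>
     (\<forall>\<eta>\<in>{0<..<1/2}. \<exists>\<gamma>\<^sub>0\<in>{0<..<\<eta>}. \<exists>\<gamma>\<^sub>1\<in>{1-\<eta><..<1}. law \<gamma>\<^sub>0 \<gamma>\<^sub>1)"

section \<open>The one-step case\<close>

definition bernoulli_measure :: "'a pmf \<Rightarrow> (nat \<Rightarrow> 'a) measure" where
  "bernoulli_measure p = (\<Pi>\<^sub>M i\<in>UNIV. measure_pmf p)"

definition seq_shift :: "(nat \<Rightarrow> 'a) \<Rightarrow> nat \<Rightarrow> 'a" where
  "seq_shift \<omega> = (\<lambda>n. \<omega> (Suc n))"

definition one_step :: "('a \<Rightarrow> real \<Rightarrow> real) \<Rightarrow> (nat \<Rightarrow> 'a) \<Rightarrow> real \<Rightarrow> real" where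
  "one_step g \<omega> = g (\<omega> 0)"

text \<open>The sequences below are indexed from 1, whereas \<^const>\<open>prob_space.tail_events\<close> expects a
  family of \<open>\<sigma>\<close>-algebras indexed from 0.\<close>

definition trivial_tail :: "'w measure \<Rightarrow> (nat \<Rightarrow> 'w \<Rightarrow> real) \<Rightarrow> bool" where
  "trivial_tail P X \<longleftrightarrow>
     (\<forall>A\<in>prob_space.tail_events P (\<lambda>n. sets (vimage_algebra (space P) (X (Suc n)) borel)).
        measure P A \<in> {0, 1})"

definition one_step_case :: "'a pmf \<Rightarrow> ('a \<Rightarrow> real \<Rightarrow> real) \<Rightarrow> bool" where
  "one_step_case p g \<longleftrightarrow>
     (\<forall>a. pmf p a > 0) \<and>
     (\<forall>a. g a \<in> unit_borel \<rightarrow>\<^sub>M unit_borel) \<and>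
     (\<forall>x\<in>{0<..<1}.
        trivial_tail (bernoulli_measure p) (\<lambda>n \<omega>. fiber_iter seq_shift (one_step g) n \<omega> x)) \<and>
     (\<forall>\<omega>. one_step g \<omega> \<in> {0<..<1} \<rightarrow> {0<..<1} \<and> mono_on {0<..<1} (one_step g \<omega>)) \<and>
     (\<forall>x\<in>{0<..<1}. \<exists>\<alpha> \<beta>. one_step g \<alpha> x < x \<and> x < one_step g \<beta> x) \<and>
     (\<exists>\<gamma>\<^sub>0 \<gamma>\<^sub>1. \<gamma>\<^sub>0 < \<gamma>\<^sub>1 \<and>
        pointwise_fiber_law (bernoulli_measure p) seq_shift (one_step g) \<gamma>\<^sub>0 \<gamma>\<^sub>1)"

section \<open>The ergodic case\<close>

definition standard_probability_space :: "'w measure \<Rightarrow> bool" where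
  "standard_probability_space P \<longleftrightarrow> prob_space P \<and>
     (\<exists>X. completely_metrizable_space X \<and> second_countable X \<and> topspace X = space P \<and>
          sets P = sigma_sets (topspace X) {U. openin X U})"

definition ergodic_measure_preserving :: "'w measure \<Rightarrow> ('w \<Rightarrow> 'w) \<Rightarrow> bool" where
  "ergodic_measure_preserving P T \<longleftrightarrow>
     T \<in> P \<rightarrow>\<^sub>M P \<and> distr P P T = P \<and>
     (\<forall>A\<in>sets P. T -` A \<inter> space P = A \<longrightarrow> measure P A \<in> {0, 1})"

text \<open>For maps that need not preserve the measure, ergodicity is phrased through forward
  invariant sets.\<close>

definition forward_ergodic :: "'b measure \<Rightarrow> ('b \<Rightarrow> 'b) \<Rightarrow> bool" where
  "forward_ergodic M F \<longleftrightarrow> (\<forall>A\<in>sets M. F ` A \<subseteq> A \<longrightarrow> measure M A \<in> {0, 1})"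

definition ergodic_case :: "'w measure \<Rightarrow> ('w \<Rightarrow> 'w) \<Rightarrow> ('w \<Rightarrow> real \<Rightarrow> real) \<Rightarrow> bool" where
  "ergodic_case P T f \<longleftrightarrow>
     standard_probability_space P \<and>
     ergodic_measure_preserving P T \<and>
     (\<forall>\<omega>\<in>space P. f \<omega> \<in> unit_borel \<rightarrow>\<^sub>M unit_borel) \<and>
     skew T f \<in> (P \<Otimes>\<^sub>M unit_leb) \<rightarrow>\<^sub>M (P \<Otimes>\<^sub>M unit_leb) \<and>
     forward_ergodic (P \<Otimes>\<^sub>M unit_leb) (skew T f) \<and>
     (\<exists>\<gamma>\<^sub>0 \<gamma>\<^sub>1. \<gamma>\<^sub>0 < \<gamma>\<^sub>1 \<and> skew_product_law P T f \<gamma>\<^sub>0 \<gamma>\<^sub>1)"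

section \<open>Accumulation points of empirical measures\<close>

definition weak_star :: "real measure topology" where
  "weak_star = topology_generated_by
     {{\<nu>. sets \<nu> = sets unit_borel \<and> prob_space \<nu> \<and> (\<integral>x. \<phi> x \<partial>\<nu>) \<in> U} | \<phi> U.
        continuous_on {0..1} (\<phi> :: real \<Rightarrow> real) \<and> open U}"

lemma topspace_weak_star:
  "topspace weak_star = {\<nu>. sets \<nu> = sets unit_borel \<and> prob_space \<nu>}" (is "_ = ?R")
proof -
  have "?R = {\<nu>. sets \<nu> = sets unit_borel \<and> prob_space \<nu> \<and> (\<integral>x. (0::real) \<partial>\<nu>) \<in> UNIV}"
    by auto
  then have "?R \<in> {{\<nu>. sets \<nu> = sets unit_borel \<and> prob_space \<nu> \<and> (\<integral>x. \<phi> x \<partial>\<nu>) \<in> U} | \<phi> U.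
        continuous_on {0..1} (\<phi> :: real \<Rightarrow> real) \<and> open U}"
    by (auto intro!: exI[of _ "\<lambda>_. 0"] exI[of _ UNIV])
  then show ?thesis
    unfolding weak_star_def topology_generated_by_topspace by blast
qed

definition empirical ::
  "('w \<Rightarrow> 'w) \<Rightarrow> ('w \<Rightarrow> real \<Rightarrow> real) \<Rightarrow> nat \<Rightarrow> 'w \<Rightarrow> real \<Rightarrow> real measure" where
  "empirical T f n \<omega> x = measure_of {0..1} (sets unit_borel)
     (\<lambda>B. ennreal (1 / real n) *
          (\<Sum>j<n. emeasure (return unit_borel (fiber_iter T f j \<omega> x)) B))"

definition dirac_mix :: "real \<Rightarrow> real measure" where
  "dirac_mix l = measure_of {0..1} (sets unit_borel)
     (\<lambda>B. ennreal l * emeasure (return unit_borel 0) B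
        + ennreal (1 - l) * emeasure (return unit_borel 1) B)"

lemma sets_empirical [simp]: "sets (empirical T f n \<omega> x) = sets unit_borel"
  unfolding empirical_def using sets.sigma_sets_eq[of unit_borel]
  by (subst sets_measure_of) (auto simp: space_restrict_space sets_restrict_space)

lemma sets_dirac_mix [simp]: "sets (dirac_mix l) = sets unit_borel"
  unfolding dirac_mix_def using sets.sigma_sets_eq[of unit_borel]
  by (subst sets_measure_of) (auto simp: space_restrict_space sets_restrict_space)

lemma emeasure_empirical:
  assumes "B \<in> sets unit_borel"
  shows "emeasure (empirical T f n \<omega> x) B =
    ennreal (1 / real n) * (\<Sum>j<n. indicator B (fiber_iter T f j \<omega> x))"
proof -
  have "countably_additive (sets unit_borel) (\<lambda>B. ennreal (1 / real n) *
          (\<Sum>j<n. emeasure (return unit_borel (fiber_iter T f j \<omega> x)) B))"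
    unfolding countably_additive_def
    by (auto simp: suminf_sum suminf_emeasure suminf_indicator)
  then have "emeasure (empirical T f n \<omega> x) B = ennreal (1 / real n) *
          (\<Sum>j<n. emeasure (return unit_borel (fiber_iter T f j \<omega> x)) B)"
    using assms
    by (intro emeasure_measure_of[OF empirical_def])
       (auto simp: positive_def sets_restrict_space)
  then show ?thesis using assms by simp
qed

lemma emeasure_dirac_mix:
  assumes "B \<in> sets unit_borel"
  shows "emeasure (dirac_mix l) B = ennreal l * indicator B 0 + ennreal (1 - l) * indicator B 1"
proof -
  have "countably_additive (sets unit_borel) (\<lambda>B. ennreal l * emeasure (return unit_borel 0) B
        + ennreal (1 - l) * emeasure (return unit_borel 1) B)"
    unfolding countably_additive_def
    by (auto simp: suminf_add[symmetric] suminf_emeasure suminf_indicator)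
  then have "emeasure (dirac_mix l) B = ennreal l * emeasure (return unit_borel 0) B
        + ennreal (1 - l) * emeasure (return unit_borel 1) B"
    using assms
    by (intro emeasure_measure_of[OF dirac_mix_def])
       (auto simp: positive_def sets_restrict_space)
  then show ?thesis using assms by simp
qed

text \<open>Accumulation points of the sequence, not of its range: a measure that is visited infinitely
  often counts.\<close>

definition empirical_limits ::
  "('w \<Rightarrow> 'w) \<Rightarrow> ('w \<Rightarrow> real \<Rightarrow> real) \<Rightarrow> 'w \<Rightarrow> real \<Rightarrow> real measure set" where
  "empirical_limits T f \<omega> x =
     {\<nu> \<in> topspace weak_star. \<forall>U. openin weak_star U \<and> \<nu> \<in> U \<longrightarrow>
        (\<exists>\<^sub>\<infinity>n. empirical T f n \<omega> x \<in> U)}"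

section \<open>Common hypotheses and conclusion\<close>

definition fixes_endpoints :: "'w measure \<Rightarrow> ('w \<Rightarrow> real \<Rightarrow> real) \<Rightarrow> bool" where
  "fixes_endpoints P f \<longleftrightarrow> (AE \<omega> in P. f \<omega> 0 = 0 \<and> f \<omega> 1 = 1)"

definition leaves_middle :: "'w measure \<Rightarrow> ('w \<Rightarrow> 'w) \<Rightarrow> ('w \<Rightarrow> real \<Rightarrow> real) \<Rightarrow> bool" where
  "leaves_middle P T f \<longleftrightarrow>
     (\<forall>\<epsilon>. 0 < \<epsilon> \<and> \<epsilon> < 1/2 \<longrightarrow>
        (AE (\<omega>, x) in P \<Otimes>\<^sub>M unit_leb. (\<lambda>n. visit_freq T f {\<epsilon>..1-\<epsilon>} n \<omega> x) \<longlonglongrightarrow> 0))"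

end

theory Submission
  imports Defs
begin

text \<open>
The \<^emph>\<open>upper frequency\<close> \<^term>\<open>upper_freq S s\<close> is the upper limit of the proportion of time that a
sequence \<open>s\<close> spends in \<open>S\<close>. The theorem follows once almost every orbit has upper frequency \<open>1\<close> both in
a neighbourhood \<open>{0..\<gamma>\<^sub>0}\<close> of \<open>0\<close> and in a neighbourhood \<open>{\<gamma>\<^sub>1..1}\<close> of \<open>1\<close>, disjoint from each other.
Indeed, orbits spend asymptotically no time away from the endpoints, so empirical measures are
asymptotic to mixtures of the two Dirac measures, with weight at \<open>0\<close> equal to the frequency of the left
half. This frequency changes by at most $1/n$ at time \<open>n\<close>, and it comes arbitrarily close to \<open>0\<close> and to
\<open>1\<close> infinitely often; so it accumulates at every point of \<open>{0..1}\<close>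
(lemma \<open>empirical_limits_eq_segment\<close>).

A fluctuation law says that the frequencies exceed \<open>\<alpha>\<close> with a probability that does not tend to \<open>0\<close>. By
Fatou's lemma, the event that the upper frequency is at least \<open>\<alpha>\<close> then has positive probability
(\<open>not_AE_limsup_less\<close>). It does not depend on finitely many initial terms of the orbit, and a
zero-one law makes it almost sure; \<open>\<alpha> \<rightarrow> 1\<close> finishes the proof. In the ergodic case the zero-one law
is ergodicity of the skew product, as the event is forward invariant (\<open>ergodic_upper_freq\<close>).

In the one-step case it is triviality of the tail, but this concerns one starting point at a time, and
the law provides only one for each endpoint. Let \<open>q x\<close> be the probability of the event for the orbit of
\<open>x\<close>. Conditioning on the first letter shows that \<open>q x\<close> is a mean of the numbers \<open>q (g a x)\<close> with positive
weights. As all of them are \<open>0\<close> or \<open>1\<close>, they are equal: \<open>q\<close> is constant along all maps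
(\<open>AE_upper_freq_step_iff\<close>). Also \<open>q\<close> is monotone, since the maps are. The jump of \<open>q\<close> would be a point that
some map moves down and another moves up, hence across the jump, which is impossible; so \<open>q\<close> is constant
on the open interval (\<open>invariant_lower_set_eq_interval\<close>), and Fubini's theorem passes to almost every pair.
\<close>

section \<open>Visit frequencies of a sequence\<close>

definition freq :: "real set \<Rightarrow> (nat \<Rightarrow> real) \<Rightarrow> nat \<Rightarrow> real" where
  "freq S s n = (\<Sum>j<n. indicator S (s j)) / real n"

text \<open>The value in the extended reals makes the upper limit total and measurable without a
boundedness argument.\<close>

definition upper_freq :: "real set \<Rightarrow> (nat \<Rightarrow> real) \<Rightarrow> ereal" where
  "upper_freq S s = limsup (\<lambda>n. ereal (freq S s n))"

lemma freq_nonneg: "0 \<le> freq S s n"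
  by (simp add: freq_def sum_nonneg)

lemma freq_le_1: "freq S s n \<le> 1"
proof -
  have "(\<Sum>j<n. indicator S (s j) :: real) \<le> real (card {..<n}) * 1"
    by (intro sum_bounded_above) (simp add: indicator_def)
  then show ?thesis by (cases "n = 0") (auto simp: freq_def divide_le_eq_1)
qed

lemma freq_mono: "(\<And>j. s j \<in> S \<Longrightarrow> t j \<in> R) \<Longrightarrow> freq S s n \<le> freq R t n"
  unfolding freq_def by (intro divide_right_mono sum_mono) (auto simp: indicator_def)

lemma upper_freq_mono: "(\<And>j. s j \<in> S \<Longrightarrow> t j \<in> R) \<Longrightarrow> upper_freq S s \<le> upper_freq R t"
  unfolding upper_freq_def by (intro Limsup_mono always_eventually allI) (simp add: freq_mono)

lemma freq_disjoint:
  assumes "S \<inter> R = {}"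
  shows "freq S s n + freq R s n \<le> 1"
proof -
  have "freq S s n + freq R s n = freq (S \<union> R) s n"
    using assms by (simp add: freq_def add_divide_distrib[symmetric] sum.distrib[symmetric]
        indicator_add)
  then show ?thesis using freq_le_1[of "S \<union> R" s n] by simp
qed

lemma freq_shift_tendsto:
  "(\<lambda>n. freq S (\<lambda>j. s (Suc j)) n - freq S s n) \<longlonglongrightarrow> 0"
proof (rule Lim_null_comparison)
  show "(\<lambda>n. 2 / real n) \<longlonglongrightarrow> 0" by real_asymp
  have "norm (freq S (\<lambda>j. s (Suc j)) n - freq S s n) \<le> 2 / real n" for n
  proof -
    have "(\<Sum>j<n. indicator S (s (Suc j))) - (\<Sum>j<n. indicator S (s j))
        = (indicator S (s n) - indicator S (s 0) :: real)"
      using sum.lessThan_Suc[of "\<lambda>j. indicator S (s j) :: real" n]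
        sum.lessThan_Suc_shift[of "\<lambda>j. indicator S (s j) :: real" n] by linarith
    then have "freq S (\<lambda>j. s (Suc j)) n - freq S s n
        = (indicator S (s n) - indicator S (s 0)) / real n"
      by (simp add: freq_def diff_divide_distrib[symmetric])
    then show ?thesis
      by (auto simp: indicator_def divide_right_mono)
  qed
  then show "\<forall>\<^sub>F n in sequentially. norm (freq S (\<lambda>j. s (Suc j)) n - freq S s n) \<le> 2 / real n"
    by simp
qed

text \<open>Moving the time origin changes each frequency by at most $2/n$. Consequently the events used below
are both tail events of an orbit and invariant under the skew product, which is what the two
zero-one arguments need.\<close>

lemma upper_freq_shift: "upper_freq S (\<lambda>j. s (Suc j)) = upper_freq S s"
proof -
  have "upper_freq S (\<lambda>j. s (Suc j)) = limsup (\<lambda>n. ereal (freq S (\<lambda>j. s (Suc j)) n - freq S s n)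
      + ereal (freq S s n))"
    by (simp add: upper_freq_def)
  also have "\<dots> = ereal 0 + upper_freq S s"
    unfolding upper_freq_def
    by (rule ereal_limsup_lim_add) (use freq_shift_tendsto[of S s] in auto)
  finally show ?thesis by simp
qed

lemma measurable_freq[measurable]:
  assumes [measurable]: "S \<in> sets borel"
  shows "(\<lambda>s. freq S s n) \<in> borel_measurable (Pi\<^sub>M UNIV (\<lambda>_. borel))"
  unfolding freq_def by measurable

lemma measurable_upper_freq[measurable]:
  assumes [measurable]: "S \<in> sets borel"
  shows "upper_freq S \<in> borel_measurable (Pi\<^sub>M UNIV (\<lambda>_. borel))"
  unfolding upper_freq_def by measurable

lemma freq_step: "\<bar>freq S s (Suc n) - freq S s n\<bar> \<le> 1 / real (Suc n)"
proof (cases "n = 0")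
  case True
  then show ?thesis by (auto simp: freq_def)
next
  case False
  have "freq S s (Suc n) - freq S s n = (indicator S (s n) - freq S s n) / real (Suc n)"
    using False by (simp add: freq_def field_simps)
  moreover have "\<bar>indicator S (s n) - freq S s n\<bar> \<le> 1"
    using freq_nonneg[of S s n] freq_le_1[of S s n] by (auto simp: indicator_def)
  ultimately show ?thesis by (simp add: divide_right_mono)
qed

text \<open>A sequence whose steps shrink to \<open>0\<close> cannot jump across a level: each time it passes from
below to above \<open>l\<close>, it lands within one step of \<open>l\<close>.\<close>

lemma frequently_near_crossing:
  fixes a :: "nat \<Rightarrow> real"
  assumes step: "\<And>n. \<bar>a (Suc n) - a n\<bar> \<le> 1 / real (Suc n)"
    and low: "\<And>e. e > 0 \<Longrightarrow> \<exists>\<^sub>F n in sequentially. a n < e"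
    and high: "\<And>e. e > 0 \<Longrightarrow> \<exists>\<^sub>F n in sequentially. 1 - e < a n"
    and l: "l \<in> {0..1}" and "e > 0"
  shows "\<exists>\<^sub>F n in sequentially. \<bar>a n - l\<bar> < e"
  unfolding frequently_sequentially
proof
  fix N
  \<comment> \<open>The extreme levels \<open>0\<close> and \<open>1\<close> need not be crossed, so the level is first moved into the open
    interval.\<close>
  define l' where "l' = max (min l (1 - min e 1 / 4)) (min e 1 / 4)"
  have l': "0 < l'" "l' < 1" "\<bar>l' - l\<bar> \<le> e / 4"
  proof -
    define c where "c = min e 1 / 4"
    have c: "0 < c" "c \<le> 1/4" "c \<le> e / 4" using \<open>e > 0\<close> by (auto simp: c_def)
    show "0 < l'" "l' < 1" "\<bar>l' - l\<bar> \<le> e / 4"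
      unfolding l'_def c_def[symmetric] using c l by (auto simp: max_def min_def)
  qed
  obtain K where K: "K \<ge> N" "1 / real (Suc K) < e / 2"
  proof -
    have "(\<lambda>n. 1 / real (Suc n)) \<longlonglongrightarrow> 0" by real_asymp
    then have "\<forall>\<^sub>F n in sequentially. 1 / real (Suc n) < e / 2"
      using \<open>e > 0\<close> by (intro order_tendstoD) auto
    then have "\<forall>\<^sub>F n in sequentially. N \<le> n \<and> 1 / real (Suc n) < e / 2"
      using eventually_ge_at_top by (rule eventually_conj[rotated])
    then show ?thesis using that by (auto dest: eventually_happens)
  qed
  obtain n where n: "n \<ge> K" "a n < l'"
    using low[OF l'(1)] unfolding frequently_sequentially by blast
  obtain m where m: "m \<ge> n" "l' \<le> a m"
    using high[of "1 - l'"] l'(2) unfolding frequently_sequentially by (auto intro: less_imp_le)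
  define k where "k = (LEAST k. n \<le> k \<and> l' \<le> a k)"
  have k: "n \<le> k \<and> l' \<le> a k" unfolding k_def by (rule LeastI[of _ m]) (use m in auto)
  with n have "k \<noteq> n" by auto
  with k obtain i where i: "k = Suc i" "n \<le> i" by (cases k) auto
  have "a i < l'"
    using not_less_Least[of i "\<lambda>k. n \<le> k \<and> l' \<le> a k"] i by (auto simp: k_def)
  then have "\<bar>a k - l'\<bar> \<le> 1 / real (Suc i)" using step[of i] k i by auto
  also have "\<dots> \<le> 1 / real (Suc K)" using i n by (auto simp: field_simps)
  also have "\<dots> < e / 2" by fact
  finally have "\<bar>a k - l\<bar> < e" using l'(3) \<open>e > 0\<close> by linarith
  then show "\<exists>n\<ge>N. \<bar>a n - l\<bar> < e" using K n i by (intro exI[of _ k]) auto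
qed

lemma frequently_freq_gt:
  assumes "1 \<le> upper_freq S s" "e > 0"
  shows "\<exists>\<^sub>F n in sequentially. 1 - e < freq S s n"
proof (rule ccontr)
  assume "\<not> ?thesis"
  then have "\<forall>\<^sub>F n in sequentially. ereal (freq S s n) \<le> ereal (1 - e)"
    by (simp add: not_frequently not_less)
  then have "upper_freq S s \<le> ereal (1 - e)"
    unfolding upper_freq_def by (rule Limsup_bounded)
  with assms(1) have "ereal 1 \<le> ereal (1 - e)" unfolding one_ereal_def by (rule order_trans)
  with assms(2) show False by simp
qed

text \<open>If the middle of the interval is visited with frequency \<open>0\<close>, a time average only remembers how
long the sequence stays in each half: near an endpoint a continuous function is almost constant, and
the remaining terms are bounded with vanishing weight.\<close>

lemma average_near_endpoint_mixture:
  fixes \<phi> :: "real \<Rightarrow> real"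
  assumes \<phi>: "continuous_on {0..1} \<phi>"
    and s: "\<And>j. s j \<in> {0..1}"
    and mid: "\<And>e. 0 < e \<Longrightarrow> e < 1/2 \<Longrightarrow> freq {e..1-e} s \<longlonglongrightarrow> 0"
  shows "(\<lambda>n. (\<Sum>j<n. \<phi> (s j)) / real n
           - (freq {0..1/2} s n * \<phi> 0 + (1 - freq {0..1/2} s n) * \<phi> 1)) \<longlonglongrightarrow> 0"
proof (rule tendstoI)
  fix e :: real assume "e > 0"
  have "compact (\<phi> ` {0..1})" using \<phi> by (rule compact_continuous_image) simp
  then obtain C where "C > 0" and "\<forall>y\<in>\<phi> ` {0..1}. norm y \<le> C"
    using compact_imp_bounded bounded_pos by blast
  then have C: "\<bar>\<phi> x\<bar> \<le> C" if "x \<in> {0..1}" for x using that by simp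
  obtain d0 where d0: "d0 > 0" "\<And>x. x \<in> {0..1} \<Longrightarrow> \<bar>x - 0\<bar> < d0 \<Longrightarrow> \<bar>\<phi> x - \<phi> 0\<bar> < e / 2"
    using \<phi>[unfolded continuous_on_iff dist_real_def, rule_format, of 0 "e / 2"] \<open>e > 0\<close> by auto
  obtain d1 where d1: "d1 > 0" "\<And>x. x \<in> {0..1} \<Longrightarrow> \<bar>x - 1\<bar> < d1 \<Longrightarrow> \<bar>\<phi> x - \<phi> 1\<bar> < e / 2"
    using \<phi>[unfolded continuous_on_iff dist_real_def, rule_format, of 1 "e / 2"] \<open>e > 0\<close> by auto
  define d where "d = min (1/4) (min d0 d1)"
  have d: "0 < d" "d < 1/2" "d \<le> d0" "d \<le> d1" using d0 d1 by (auto simp: d_def)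
  define \<psi> where "\<psi> x = \<phi> x - (indicator {0..1/2} x * \<phi> 0 + (1 - indicator {0..1/2} x) * \<phi> 1)" for x
  have \<psi>: "\<bar>\<psi> x\<bar> \<le> e / 2 + 2 * C * indicator {d..1-d} x" if x: "x \<in> {0..1}" for x
  proof (cases "x \<in> {d..1-d}")
    case True
    have "\<bar>\<psi> x\<bar> \<le> 2 * C"
      using C[OF x] C[of 0] C[of 1] by (auto simp: \<psi>_def indicator_def)
    then show ?thesis using True \<open>e > 0\<close> by simp
  next
    case False
    then consider "x < d" | "x > 1 - d" using x by auto
    then show ?thesis
    proof cases
      case 1
      then show ?thesis using d0(2)[of x] d x by (auto simp: \<psi>_def indicator_def)
    next
      case 2
      then show ?thesis using d1(2)[of x] d x by (auto simp: \<psi>_def indicator_def)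
    qed
  qed
  have "\<forall>\<^sub>F n in sequentially. freq {d..1-d} s n < e / (4 * C)"
    using mid[OF d(1,2)] \<open>e > 0\<close> \<open>C > 0\<close> by (intro order_tendstoD) auto
  then show "\<forall>\<^sub>F n in sequentially. dist ((\<Sum>j<n. \<phi> (s j)) / real n
           - (freq {0..1/2} s n * \<phi> 0 + (1 - freq {0..1/2} s n) * \<phi> 1)) 0 < e"
    using eventually_gt_at_top[of 0]
  proof eventually_elim
    case (elim n)
    have "(\<Sum>j<n. \<psi> (s j)) = (\<Sum>j<n. \<phi> (s j)) - ((\<Sum>j<n. indicator {0..1/2} (s j)) * \<phi> 0
        + (real n - (\<Sum>j<n. indicator {0..1/2} (s j))) * \<phi> 1)"
      by (simp add: \<psi>_def sum_subtractf sum.distrib sum_distrib_right[symmetric])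
    then have eq: "(\<Sum>j<n. \<phi> (s j)) / real n
           - (freq {0..1/2} s n * \<phi> 0 + (1 - freq {0..1/2} s n) * \<phi> 1) = (\<Sum>j<n. \<psi> (s j)) / real n"
      using \<open>0 < n\<close> by (simp add: freq_def field_simps)
    have "\<bar>\<Sum>j<n. \<psi> (s j)\<bar> \<le> (\<Sum>j<n. \<bar>\<psi> (s j)\<bar>)" by (rule sum_abs)
    also have "\<dots> \<le> (\<Sum>j<n. e / 2 + 2 * C * indicator {d..1-d} (s j))"
      by (intro sum_mono \<psi> s)
    also have "\<dots> = real n * (e / 2) + 2 * C * (\<Sum>j<n. indicator {d..1-d} (s j))"
      by (simp add: sum.distrib sum_distrib_left)
    finally have "\<bar>(\<Sum>j<n. \<psi> (s j)) / real n\<bar> \<le> e / 2 + 2 * C * freq {d..1-d} s n"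
      using \<open>0 < n\<close> by (simp add: freq_def field_simps)
    also have "\<dots> < e" using elim(1) \<open>C > 0\<close> by (simp add: field_simps)
    finally show ?case unfolding eq by simp
  qed
qed

section \<open>Empirical measures\<close>

abbreviation orbit :: "('w \<Rightarrow> 'w) \<Rightarrow> ('w \<Rightarrow> real \<Rightarrow> real) \<Rightarrow> 'w \<Rightarrow> real \<Rightarrow> nat \<Rightarrow> real" where
  "orbit T f \<omega> x \<equiv> (\<lambda>j. fiber_iter T f j \<omega> x)"

lemma visit_freq_eq_freq: "visit_freq T f S n \<omega> x = freq S (orbit T f \<omega> x) n"
  by (simp add: visit_freq_def freq_def)

lemma measurable_into_unit_borel:
  "(\<And>y. h y \<in> {0..1}) \<Longrightarrow> h \<in> measure_pmf q \<rightarrow>\<^sub>M unit_borel"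
  by (intro measurable_restrict_space2) auto

text \<open>Writing both kinds of measure as images of finitely supported probability measures yields their
integrals and their total mass.\<close>

lemma empirical_eq_distr:
  assumes orb: "\<And>j. fiber_iter T f j \<omega> x \<in> {0..1}" and "n > 0"
  shows "empirical T f n \<omega> x = distr (measure_pmf (pmf_of_set {..<n})) unit_borel (orbit T f \<omega> x)"
proof (rule measure_eqI)
  fix B assume "B \<in> sets (empirical T f n \<omega> x)"
  then have B: "B \<in> sets unit_borel" by simp
  have ne: "{..<n} \<noteq> {}" using \<open>n > 0\<close> by auto
  let ?C = "{..<n} \<inter> orbit T f \<omega> x -` B"
  have "emeasure (distr (measure_pmf (pmf_of_set {..<n})) unit_borel (orbit T f \<omega> x)) B
      = ennreal (real (card ?C) / real n)"
    using B orb \<open>n > 0\<close>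
    by (subst emeasure_distr) (auto intro!: measurable_into_unit_borel simp: emeasure_pmf_of_set[OF ne])
  moreover have "(\<Sum>j<n. indicator B (fiber_iter T f j \<omega> x) :: ennreal) = of_nat (card ?C)"
    by (subst sum_indicator_eq_card[symmetric]) (auto simp: indicator_def intro!: sum.cong)
  ultimately show "emeasure (empirical T f n \<omega> x) B
      = emeasure (distr (measure_pmf (pmf_of_set {..<n})) unit_borel (orbit T f \<omega> x)) B"
    using \<open>n > 0\<close> by (simp add: emeasure_empirical[OF B] ennreal_of_nat_eq_real_of_nat ennreal_mult[symmetric])
qed simp

lemma dirac_mix_eq_distr:
  assumes l: "l \<in> {0..1}"
  shows "dirac_mix l = distr (measure_pmf (bernoulli_pmf l)) unit_borel (\<lambda>b. if b then 0 else 1)"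
proof (rule measure_eqI)
  fix B assume "B \<in> sets (dirac_mix l)"
  then have B: "B \<in> sets unit_borel" by simp
  let ?h = "\<lambda>b. if b then 0 else 1 :: real"
  have "emeasure (distr (measure_pmf (bernoulli_pmf l)) unit_borel ?h) B
     = (\<integral>\<^sup>+b. indicator (?h -` B) b \<partial>measure_pmf (bernoulli_pmf l))"
    using B by (subst emeasure_distr) (auto intro!: measurable_into_unit_borel)
  then show "emeasure (dirac_mix l) B
      = emeasure (distr (measure_pmf (bernoulli_pmf l)) unit_borel ?h) B"
    using l by (simp add: emeasure_dirac_mix[OF B] indicator_def)
qed simp

lemma integral_empirical:
  fixes \<phi> :: "real \<Rightarrow> real"
  assumes "\<And>j. fiber_iter T f j \<omega> x \<in> {0..1}" "n > 0" "continuous_on {0..1} \<phi>"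
  shows "(\<integral>y. \<phi> y \<partial>empirical T f n \<omega> x) = (\<Sum>j<n. \<phi> (fiber_iter T f j \<omega> x)) / real n"
proof -
  have "{..<n} \<noteq> {}" using assms(2) by auto
  then show ?thesis
    unfolding empirical_eq_distr[where T=T and f=f, OF assms(1,2)]
    using assms
    by (subst integral_distr)
       (auto intro!: measurable_into_unit_borel borel_measurable_continuous_on_restrict
         simp: integral_pmf_of_set)
qed

lemma integral_dirac_mix:
  fixes \<phi> :: "real \<Rightarrow> real"
  assumes "l \<in> {0..1}" "continuous_on {0..1} \<phi>"
  shows "(\<integral>y. \<phi> y \<partial>dirac_mix l) = l * \<phi> 0 + (1 - l) * \<phi> 1"
  unfolding dirac_mix_eq_distr[OF assms(1)]
  using assms
  by (subst integral_distr)
     (auto intro!: measurable_into_unit_borel borel_measurable_continuous_on_restrict)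

lemma empirical_in_topspace:
  assumes "\<And>j. fiber_iter T f j \<omega> x \<in> {0..1}" "n > 0"
  shows "empirical T f n \<omega> x \<in> topspace weak_star"
  unfolding topspace_weak_star mem_Collect_eq
  by (subst (2) empirical_eq_distr)
    (use assms in \<open>auto intro!: prob_space.prob_space_distr prob_space_measure_pmf measurable_into_unit_borel\<close>)

lemma dirac_mix_in_topspace:
  assumes "l \<in> {0..1}"
  shows "dirac_mix l \<in> topspace weak_star"
  unfolding topspace_weak_star mem_Collect_eq
  by (subst (2) dirac_mix_eq_distr)
    (use assms in \<open>auto intro!: prob_space.prob_space_distr prob_space_measure_pmf measurable_into_unit_borel\<close>)

text \<open>The nonnegative function $y(1-y)$ vanishes only at the endpoints, so this one test function already
detects that a measure is concentrated there.\<close>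

lemma measure_on_endpoints_eq_dirac_mix:
  assumes sets: "sets \<nu> = sets unit_borel" and "prob_space \<nu>"
    and zero: "(\<integral>y. y * (1 - y) \<partial>\<nu>) = 0"
  shows "\<nu> = dirac_mix (measure \<nu> {0}) \<and> measure \<nu> {0} \<in> {0..1}"
proof
  interpret prob_space \<nu> by fact
  show l: "measure \<nu> {0} \<in> {0..1}" by simp
  have sp: "space \<nu> = {0..1}" using sets_eq_imp_space_eq[OF sets] by (simp add: space_restrict_space)
  have B_sets: "B \<in> sets \<nu> \<longleftrightarrow> B \<in> sets borel \<and> B \<subseteq> {0..1}" for B
    unfolding sets by (auto simp: sets_restrict_space)
  have meas: "(\<lambda>y. y * (1 - y)) \<in> borel_measurable \<nu>"
    unfolding measurable_cong_sets[OF sets refl]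
    by (intro borel_measurable_continuous_on_restrict continuous_intros)
  have ge: "AE y in \<nu>. 0 \<le> y * (1 - y)" by (rule AE_I2) (auto simp: sp)
  have "integrable \<nu> (\<lambda>y. y * (1 - y))"
    using meas by (rule integrable_const_bound[of _ 1, rotated])
      (auto intro!: AE_I2 simp: sp abs_mult mult_le_one)
  then have "AE y in \<nu>. y * (1 - y) = 0"
    using zero integral_nonneg_eq_0_iff_AE[OF _ ge] by blast
  then have ends: "AE y in \<nu>. y = 0 \<or> y = 1" by eventually_elim auto
  have "emeasure \<nu> {0, 1} = 1"
    by (rule emeasure_eq_1_AE) (use ends in \<open>auto simp: B_sets\<close>)
  moreover have "emeasure \<nu> {0, 1} = emeasure \<nu> {0} + emeasure \<nu> {1}"
    by (subst plus_emeasure) (auto simp: B_sets insert_commute)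
  ultimately have m1: "measure \<nu> {1} = 1 - measure \<nu> {0}"
    by (simp add: emeasure_eq_measure flip: ennreal_plus)
  have points[measurable]: "{0} \<in> sets \<nu>" "{1} \<in> sets \<nu>" by (auto simp: B_sets)
  show "\<nu> = dirac_mix (measure \<nu> {0})"
  proof (rule measure_eqI)
    fix B assume B: "B \<in> sets \<nu>"
    have "emeasure \<nu> B = (\<integral>\<^sup>+y. indicator B y \<partial>\<nu>)" using B by simp
    also have "\<dots> = (\<integral>\<^sup>+y. indicator B 0 * indicator {0} y + indicator B 1 * indicator {1} y \<partial>\<nu>)"
      using ends by (intro nn_integral_cong_AE) (auto elim!: eventually_mono simp: indicator_def)
    also have "\<dots> = indicator B 0 * emeasure \<nu> {0} + indicator B 1 * emeasure \<nu> {1}"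
      by (subst nn_integral_add)
        (auto simp: nn_integral_cmult points)
    also have "\<dots> = emeasure (dirac_mix (measure \<nu> {0})) B"
      using B unfolding sets
      by (simp add: emeasure_dirac_mix emeasure_eq_measure m1 mult.commute)
    finally show "emeasure \<nu> B = emeasure (dirac_mix (measure \<nu> {0})) B" .
  qed (simp add: sets)
qed

text \<open>The deterministic core. Let \<open>a n\<close> be the frequency of the left half up to time \<open>n\<close>. Integrals
against the empirical measures are asymptotic to those against \<open>dirac_mix (a n)\<close>. Hence limits are
mixtures of the two Dirac measures; and since \<open>a n\<close> moves by at most $1/(n+1)$ while it comes close
to \<open>0\<close> and to \<open>1\<close> infinitely often, every weight \<open>l\<close> is a limit of \<open>a\<close> along some times.\<close>

lemma empirical_limits_eq_segment:
  assumes orb: "\<And>j. fiber_iter T f j \<omega> x \<in> {0..1}"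
    and mid: "\<And>e. 0 < e \<Longrightarrow> e < 1/2 \<Longrightarrow> (\<lambda>n. visit_freq T f {e..1-e} n \<omega> x) \<longlonglongrightarrow> 0"
    and \<gamma>: "\<gamma>\<^sub>0 \<le> 1/2" "\<gamma>\<^sub>1 > 1/2"
    and low: "1 \<le> upper_freq {0..\<gamma>\<^sub>0} (orbit T f \<omega> x)"
    and high: "1 \<le> upper_freq {\<gamma>\<^sub>1..1} (orbit T f \<omega> x)"
  shows "empirical_limits T f \<omega> x = {dirac_mix l | l. l \<in> {0..1}}"
proof -
  let ?s = "orbit T f \<omega> x"
  define a where "a = freq {0..1/2} ?s"
  have D: "(\<lambda>n. (\<integral>y. \<phi> y \<partial>empirical T f n \<omega> x) - (a n * \<phi> 0 + (1 - a n) * \<phi> 1)) \<longlonglongrightarrow> 0"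
    if "continuous_on {0..1} \<phi>" for \<phi>
  proof -
    have "(\<lambda>n. (\<Sum>j<n. \<phi> (?s j)) / real n - (a n * \<phi> 0 + (1 - a n) * \<phi> 1)) \<longlonglongrightarrow> 0"
      using average_near_endpoint_mixture[OF that orb] mid by (simp add: visit_freq_eq_freq a_def)
    then show ?thesis
      by (rule Lim_transform_eventually)
        (use integral_empirical[where T=T and f=f, OF orb _ that] in \<open>auto intro!: eventually_mono[OF eventually_gt_at_top[of 0]]\<close>)
  qed
  have a_high: "\<exists>\<^sub>F n in sequentially. 1 - e < a n" if "e > 0" for e
    using frequently_freq_gt[OF low that]
  proof (rule frequently_elim1)
    fix n assume "1 - e < freq {0..\<gamma>\<^sub>0} ?s n"
    moreover have "freq {0..\<gamma>\<^sub>0} ?s n \<le> a n"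
      unfolding a_def using \<gamma> by (intro freq_mono) auto
    ultimately show "1 - e < a n" by linarith
  qed
  have a_low: "\<exists>\<^sub>F n in sequentially. a n < e" if "e > 0" for e
    using frequently_freq_gt[OF high that]
  proof (rule frequently_elim1)
    fix n assume "1 - e < freq {\<gamma>\<^sub>1..1} ?s n"
    moreover have "a n + freq {\<gamma>\<^sub>1..1} ?s n \<le> 1"
      unfolding a_def using \<gamma> by (intro freq_disjoint) auto
    ultimately show "a n < e" by simp
  qed
  show ?thesis
  proof (intro equalityI subsetI)
    fix \<nu> assume \<nu>: "\<nu> \<in> empirical_limits T f \<omega> x"
    then have top: "sets \<nu> = sets unit_borel" "prob_space \<nu>"
      by (auto simp: empirical_limits_def topspace_weak_star)
    let ?\<phi> = "\<lambda>y::real. y * (1 - y)"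
    have cont: "continuous_on {0..1} ?\<phi>" by (intro continuous_intros)
    have "(\<integral>y. ?\<phi> y \<partial>\<nu>) = 0"
    proof (rule ccontr)
      assume ne: "(\<integral>y. ?\<phi> y \<partial>\<nu>) \<noteq> 0"
      define e where "e = \<bar>\<integral>y. ?\<phi> y \<partial>\<nu>\<bar>"
      define V where "V = {t::real. \<bar>t\<bar> > e / 2}"
      have "open V" unfolding V_def by (intro open_Collect_less continuous_intros)
      define U where "U = {\<nu>. sets \<nu> = sets unit_borel \<and> prob_space \<nu> \<and> (\<integral>x. ?\<phi> x \<partial>\<nu>) \<in> V}"
      have "openin weak_star U" unfolding weak_star_def U_def
        by (intro topology_generated_by_Basis CollectI exI[of _ ?\<phi>] exI[of _ V] conjI cont \<open>open V\<close> refl)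
      moreover have "\<nu> \<in> U" using ne top by (auto simp: U_def V_def e_def)
      ultimately have "\<exists>\<^sub>\<infinity>n. empirical T f n \<omega> x \<in> U"
        using \<nu> by (auto simp: empirical_limits_def)
      then have fr: "\<exists>\<^sub>F n in sequentially. e / 2 < \<bar>\<integral>y. ?\<phi> y \<partial>empirical T f n \<omega> x\<bar>"
        by (auto simp: U_def V_def cofinite_eq_sequentially elim: frequently_elim1)
      have "(\<lambda>n. \<bar>\<integral>y. ?\<phi> y \<partial>empirical T f n \<omega> x\<bar>) \<longlonglongrightarrow> \<bar>0\<bar>"
        using D[OF cont] by (intro tendsto_rabs) simp
      then have "\<forall>\<^sub>F n in sequentially. \<bar>\<integral>y. ?\<phi> y \<partial>empirical T f n \<omega> x\<bar> < e / 2"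
        using ne by (intro order_tendstoD) (auto simp: e_def)
      then have "\<forall>\<^sub>F n in sequentially. \<not> e / 2 < \<bar>\<integral>y. ?\<phi> y \<partial>empirical T f n \<omega> x\<bar>"
        by eventually_elim simp
      with fr show False by (simp add: frequently_def)
    qed
    then show "\<nu> \<in> {dirac_mix l | l. l \<in> {0..1}}"
      using measure_on_endpoints_eq_dirac_mix[OF top] by blast
  next
    fix \<nu> assume "\<nu> \<in> {dirac_mix l | l. l \<in> {0..1}}"
    then obtain l where \<nu>: "\<nu> = dirac_mix l" and l: "l \<in> {0..1}" by auto
    \<comment> \<open>The filter of large times \<open>n\<close> with \<open>a n\<close> close to \<open>l\<close>; it replaces the choice of a
      subsequence.\<close>
    define F where "F = inf sequentially (filtercomap a (nhds l))"
    have F_bot: "F \<noteq> bot"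
    proof
      assume "F = bot"
      then have "eventually (\<lambda>_. False) (inf sequentially (filtercomap a (nhds l)))" by (simp add: F_def)
      then obtain Q R where Q: "eventually Q sequentially" and R: "eventually R (filtercomap a (nhds l))"
        and QR: "\<And>n. Q n \<Longrightarrow> R n \<Longrightarrow> False" unfolding eventually_inf by auto
      obtain R' where R': "eventually R' (nhds l)" "\<And>n. R' (a n) \<Longrightarrow> R n"
        using R by (auto simp: eventually_filtercomap)
      obtain e where e: "e > 0" "\<And>y. dist y l < e \<Longrightarrow> R' y"
        using R'(1) by (auto simp: eventually_nhds_metric)
      have "\<exists>\<^sub>F n in sequentially. \<bar>a n - l\<bar> < e"
        unfolding a_def by (rule frequently_near_crossing[OF freq_step a_low[unfolded a_def]
            a_high[unfolded a_def] l e(1)])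
      then have "\<exists>\<^sub>F n in sequentially. R n"
        by (rule frequently_elim1) (use R' e in \<open>auto simp: dist_real_def\<close>)
      moreover have "\<forall>\<^sub>F n in sequentially. \<not> R n"
        using Q by eventually_elim (use QR in blast)
      ultimately show False by (simp add: frequently_def)
    qed
    have F_le: "F \<le> sequentially" by (simp add: F_def)
    have a_F: "(a \<longlongrightarrow> l) F"
      unfolding F_def filterlim_iff_le_filtercomap by simp
    have "\<exists>\<^sub>\<infinity>n. empirical T f n \<omega> x \<in> U" if U: "openin weak_star U" "\<nu> \<in> U" for U
    proof -
      have "generate_topology_on {{\<nu>. sets \<nu> = sets unit_borel \<and> prob_space \<nu> \<and> (\<integral>x. \<phi> x \<partial>\<nu>) \<in> U} | \<phi> U.
        continuous_on {0..1} (\<phi> :: real \<Rightarrow> real) \<and> open U} U"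
        using U(1) unfolding weak_star_def by (rule openin_topology_generated_by)
      then have "\<forall>\<^sub>F n in F. empirical T f n \<omega> x \<in> U"
        using U(2)
      proof (induction rule: generate_topology_on.induct)
        case Empty
        then show ?case by simp
      next
        case (Int A B)
        then have "\<forall>\<^sub>F n in F. empirical T f n \<omega> x \<in> A" "\<forall>\<^sub>F n in F. empirical T f n \<omega> x \<in> B"
          by simp_all
        then show ?case by eventually_elim simp
      next
        case (UN K)
        then obtain k where k: "k \<in> K" "\<nu> \<in> k" by auto
        show ?case using UN.IH[OF k] by eventually_elim (use k in auto)
      next
        case (Basis V)
        then obtain \<phi> W where V: "V = {\<nu>. sets \<nu> = sets unit_borel \<and> prob_space \<nu> \<and> (\<integral>x. \<phi> x \<partial>\<nu>) \<in> W}"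
          and \<phi>: "continuous_on {0..1} (\<phi> :: real \<Rightarrow> real)" and "open W" by auto
        have "((\<lambda>n. ((\<integral>y. \<phi> y \<partial>empirical T f n \<omega> x) - (a n * \<phi> 0 + (1 - a n) * \<phi> 1))
            + (a n * \<phi> 0 + (1 - a n) * \<phi> 1)) \<longlongrightarrow> 0 + (l * \<phi> 0 + (1 - l) * \<phi> 1)) F"
          by (intro tendsto_intros a_F tendsto_mono[OF F_le D[OF \<phi>]])
        then have "((\<lambda>n. \<integral>y. \<phi> y \<partial>empirical T f n \<omega> x) \<longlongrightarrow> (\<integral>y. \<phi> y \<partial>\<nu>)) F"
          by (simp add: \<nu> integral_dirac_mix[OF l \<phi>])
        then have "\<forall>\<^sub>F n in F. (\<integral>y. \<phi> y \<partial>empirical T f n \<omega> x) \<in> W"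
          using Basis \<open>open W\<close> by (auto simp: V intro: topological_tendstoD)
        moreover have "\<forall>\<^sub>F n in F. n > 0"
          using eventually_gt_at_top[of "0::nat"] F_le by (rule filter_leD[rotated])
        ultimately show ?case
        proof eventually_elim
          case (elim n)
          then show ?case using empirical_in_topspace[where T=T and f=f, OF orb elim(2)]
            by (simp add: V topspace_weak_star)
        qed
      qed
      show ?thesis
        unfolding cofinite_eq_sequentially frequently_def
      proof
        assume "\<forall>\<^sub>F n in sequentially. empirical T f n \<omega> x \<notin> U"
        then have "\<forall>\<^sub>F n in F. empirical T f n \<omega> x \<notin> U" using F_le by (rule filter_leD[rotated])
        with \<open>\<forall>\<^sub>F n in F. empirical T f n \<omega> x \<in> U\<close> have "\<forall>\<^sub>F n in F. False"
          by eventually_elim simp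
        with F_bot show False by (simp add: eventually_False)
      qed
    qed
    then show "\<nu> \<in> empirical_limits T f \<omega> x"
      unfolding empirical_limits_def
      using dirac_mix_in_topspace[OF l, folded \<nu>] by (intro CollectI conjI allI impI) simp_all
  qed
qed

section \<open>Random orbits\<close>

lemma prob_space_unit_leb: "prob_space unit_leb"
  by (rule prob_space_restrict_space) simp_all

lemma space_unit_leb[simp]: "space unit_leb = {0..1}"
  by (simp add: space_restrict_space)

text \<open>The recursion of \<^const>\<open>fiber_iter\<close> adds a map at the end of the orbit; invariance under the
skew product and conditioning on the first letter need it at the beginning.\<close>

lemma orbit_shift: "fiber_iter T f (Suc n) \<omega> x = fiber_iter T f n (T \<omega>) (f \<omega> x)"
  by (induction n) (simp_all add: funpow_swap1)

lemma fiber_iter_eq_skew: "fiber_iter T f n (fst z) (snd z) = snd ((skew T f ^^ n) z)"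
  by (cases z) (simp add: skew_funpow)

lemma measurable_orbit:
  assumes [measurable]: "skew T f \<in> (P \<Otimes>\<^sub>M unit_leb) \<rightarrow>\<^sub>M (P \<Otimes>\<^sub>M unit_leb)"
  shows "(\<lambda>z. orbit T f (fst z) (snd z)) \<in> (P \<Otimes>\<^sub>M unit_leb) \<rightarrow>\<^sub>M Pi\<^sub>M UNIV (\<lambda>_. borel)"
proof (rule measurable_PiM_single')
  fix n :: nat
  have "(\<lambda>x. x) \<in> unit_leb \<rightarrow>\<^sub>M borel" by (rule measurable_restrict_space1) simp
  then have [measurable]: "snd \<in> (P \<Otimes>\<^sub>M unit_leb) \<rightarrow>\<^sub>M borel"
    by (rule measurable_compose[OF measurable_snd])
  show "(\<lambda>z. fiber_iter T f n (fst z) (snd z)) \<in> borel_measurable (P \<Otimes>\<^sub>M unit_leb)"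
    unfolding fiber_iter_eq_skew by measurable
qed auto

lemma orbit_in_unit:
  assumes "skew T f \<in> (P \<Otimes>\<^sub>M unit_leb) \<rightarrow>\<^sub>M (P \<Otimes>\<^sub>M unit_leb)"
    and "(\<omega>, x) \<in> space (P \<Otimes>\<^sub>M unit_leb)"
  shows "fiber_iter T f n \<omega> x \<in> {0..1}"
proof -
  have "(skew T f ^^ n) (\<omega>, x) \<in> space (P \<Otimes>\<^sub>M unit_leb)"
    by (induction n) (use assms measurable_space[OF assms(1)] in auto)
  then show ?thesis by (simp add: skew_funpow space_pair_measure)
qed

text \<open>If the upper limit were almost surely below \<open>\<alpha>\<close>, the indicators of \<open>Z n \<le> \<alpha>\<close> would tend to \<open>1\<close>
almost surely, and Fatou's lemma would force their integrals to have lower limit at least \<open>1\<close>. In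
this way a fluctuation law, which concerns each time separately, produces a positive probability of
fluctuation along single orbits.\<close>

lemma (in prob_space) not_AE_limsup_less:
  fixes Z :: "nat \<Rightarrow> 'a \<Rightarrow> real"
  assumes [measurable]: "\<And>n. Z n \<in> borel_measurable M"
    and less: "liminf (\<lambda>n. emeasure M {x \<in> space M. Z n x \<le> \<alpha>}) < 1"
  shows "\<not> (AE x in M. limsup (\<lambda>n. ereal (Z n x)) < ereal \<alpha>)"
proof
  assume AE: "AE x in M. limsup (\<lambda>n. ereal (Z n x)) < ereal \<alpha>"
  let ?E = "\<lambda>n. {x \<in> space M. Z n x \<le> \<alpha>}"
  have "AE x in M. (1::ennreal) \<le> liminf (\<lambda>n. indicator (?E n) x)"
    using AE AE_space
  proof eventually_elim
    case (elim x)
    have "\<forall>\<^sub>F n in sequentially. (1::ennreal) \<le> indicator (?E n) x"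
      using Limsup_lessD[OF elim(1)] by eventually_elim (use elim(2) in auto)
    then show ?case by (rule Liminf_bounded)
  qed
  then have "(\<integral>\<^sup>+x. 1 \<partial>M) \<le> (\<integral>\<^sup>+x. liminf (\<lambda>n. indicator (?E n) x) \<partial>M)"
    by (rule nn_integral_mono_AE)
  also have "\<dots> \<le> liminf (\<lambda>n. \<integral>\<^sup>+x. indicator (?E n) x \<partial>M)"
    by (rule nn_integral_liminf) measurable
  also have "\<dots> = liminf (\<lambda>n. emeasure M (?E n))" by simp
  finally show False using less by (simp add: emeasure_space_1)
qed

lemma AE_one_le_ereal:
  fixes h :: "'a \<Rightarrow> ereal"
  assumes "\<And>\<alpha>. 0 < \<alpha> \<Longrightarrow> \<alpha> < 1 \<Longrightarrow> AE z in M. ereal \<alpha> \<le> h z"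
  shows "AE z in M. 1 \<le> h z"
proof -
  have "AE z in M. \<forall>k. ereal (1 - 1 / real (k + 2)) \<le> h z"
    unfolding AE_all_countable by (intro allI assms) (simp_all add: field_simps)
  then show ?thesis
  proof eventually_elim
    case (elim z)
    have "(\<lambda>k. ereal (1 - 1 / real (k + 2))) \<longlonglongrightarrow> ereal 1"
      by (intro tendsto_ereal) real_asymp
    then have "ereal 1 \<le> h z"
      by (rule LIMSEQ_le_const2) (use elim in auto)
    then show ?case by (simp add: one_ereal_def)
  qed
qed

text \<open>This reduces both cases to the same two bounds on upper visit frequencies. It is enough to have
them for one neighbourhood of each endpoint, because the middle carries no frequency.\<close>

lemma AE_empirical_limits_eq_segment:
  assumes skew: "skew T f \<in> (P \<Otimes>\<^sub>M unit_leb) \<rightarrow>\<^sub>M (P \<Otimes>\<^sub>M unit_leb)"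
    and mid: "leaves_middle P T f"
    and \<gamma>: "\<gamma>\<^sub>0 \<le> 1/2" "1/2 < \<gamma>\<^sub>1"
    and low: "AE z in P \<Otimes>\<^sub>M unit_leb. 1 \<le> upper_freq {0..\<gamma>\<^sub>0} (orbit T f (fst z) (snd z))"
    and high: "AE z in P \<Otimes>\<^sub>M unit_leb. 1 \<le> upper_freq {\<gamma>\<^sub>1..1} (orbit T f (fst z) (snd z))"
  shows "AE (\<omega>, x) in P \<Otimes>\<^sub>M unit_leb. empirical_limits T f \<omega> x = {dirac_mix l | l. l \<in> {0..1}}"
proof -
  \<comment> \<open>One null set must serve all \<open>e\<close>, so the hypothesis is used for a sequence of values below $1/2$
    that tends to \<open>0\<close>.\<close>
  have "AE z in P \<Otimes>\<^sub>M unit_leb. \<forall>k. freq {1 / real (k + 3)..1 - 1 / real (k + 3)}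
          (orbit T f (fst z) (snd z)) \<longlonglongrightarrow> 0"
    unfolding AE_all_countable
  proof
    fix k
    have "0 < 1 / real (k + 3)" "1 / real (k + 3) < 1 / 2" by (auto simp: field_simps)
    then have "AE (\<omega>, x) in P \<Otimes>\<^sub>M unit_leb.
        (\<lambda>n. visit_freq T f {1 / real (k + 3)..1 - 1 / real (k + 3)} n \<omega> x) \<longlonglongrightarrow> 0"
      using mid unfolding leaves_middle_def by blast
    then show "AE z in P \<Otimes>\<^sub>M unit_leb. freq {1 / real (k + 3)..1 - 1 / real (k + 3)}
          (orbit T f (fst z) (snd z)) \<longlonglongrightarrow> 0"
      by (simp add: visit_freq_eq_freq split_beta')
  qed
  then show ?thesis using low high AE_space
  proof eventually_elim
    case (elim z)
    obtain \<omega> x where z: "z = (\<omega>, x)" by (cases z)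
    have "(\<lambda>n. visit_freq T f {e..1-e} n \<omega> x) \<longlonglongrightarrow> 0" if "0 < e" "e < 1/2" for e
    proof -
      have "(\<lambda>k. 1 / real (k + 3)) \<longlonglongrightarrow> 0" by real_asymp
      then have "\<forall>\<^sub>F k in sequentially. 1 / real (k + 3) < e" using \<open>0 < e\<close> by (rule order_tendstoD)
      then obtain k where k: "1 / real (k + 3) < e" by (auto dest: eventually_happens)
      show ?thesis
      proof (rule tendsto_sandwich[OF _ _ tendsto_const])
        show "(\<lambda>n. freq {1 / real (k + 3)..1 - 1 / real (k + 3)} (orbit T f \<omega> x) n) \<longlonglongrightarrow> 0"
          using elim(1) z by simp
        show "\<forall>\<^sub>F n in sequentially. visit_freq T f {e..1-e} n \<omega> x
            \<le> freq {1 / real (k + 3)..1 - 1 / real (k + 3)} (orbit T f \<omega> x) n"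
          unfolding visit_freq_eq_freq using k by (intro always_eventually allI freq_mono) auto
      qed (simp add: visit_freq_eq_freq freq_nonneg)
    qed
    then have "empirical_limits T f \<omega> x = {dirac_mix l | l. l \<in> {0..1}}"
      using elim z \<gamma> orbit_in_unit[OF skew] by (intro empirical_limits_eq_segment) auto
    then show ?case by (simp add: z)
  qed
qed

section \<open>The ergodic case\<close>

text \<open>The set where the upper visit frequency is at least \<open>\<alpha>\<close> is forward invariant and, by the law, not
null; ergodicity makes it of full measure.\<close>

lemma ergodic_upper_freq:
  assumes P: "prob_space P" and erg: "forward_ergodic (P \<Otimes>\<^sub>M unit_leb) (skew T f)"
    and skew[measurable]: "skew T f \<in> (P \<Otimes>\<^sub>M unit_leb) \<rightarrow>\<^sub>M (P \<Otimes>\<^sub>M unit_leb)"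
    and S: "S \<in> sets borel"
    and law: "liminf (\<lambda>n. emeasure (P \<Otimes>\<^sub>M unit_leb)
          {(\<omega>, x) \<in> space (P \<Otimes>\<^sub>M unit_leb). visit_freq T f S n \<omega> x \<le> \<alpha>}) < 1"
  shows "AE z in P \<Otimes>\<^sub>M unit_leb. ereal \<alpha> \<le> upper_freq S (orbit T f (fst z) (snd z))"
proof -
  let ?M = "P \<Otimes>\<^sub>M unit_leb" and ?u = "\<lambda>z. upper_freq S (orbit T f (fst z) (snd z))"
  interpret prob_space ?M by (rule prob_space_pair[OF P prob_space_unit_leb])
  note orb[measurable] = measurable_orbit[OF skew]
  have [measurable]: "?u \<in> borel_measurable ?M"
    by (rule measurable_compose[OF orb measurable_upper_freq[OF S]])
  define A where "A = {z \<in> space ?M. ereal \<alpha> \<le> ?u z}"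
  have [measurable]: "A \<in> sets ?M" unfolding A_def by measurable
  have "skew T f ` A \<subseteq> A"
  proof
    fix z assume "z \<in> skew T f ` A"
    then obtain y where y: "y \<in> A" "z = skew T f y" by auto
    have "?u z = upper_freq S (\<lambda>j. fiber_iter T f (Suc j) (fst y) (snd y))"
      unfolding y(2) orbit_shift by (simp add: skew_def split_beta')
    also have "\<dots> = ?u y" by (rule upper_freq_shift)
    finally show "z \<in> A" using y measurable_space[OF skew] by (auto simp: A_def)
  qed
  then have "prob A = 0 \<or> prob A = 1"
    using erg by (auto simp: forward_ergodic_def)
  moreover have "prob A \<noteq> 0"
  proof
    assume "prob A = 0"
    then have "AE z in ?M. z \<notin> A" by (subst (asm) prob_eq_0) auto
    then have "AE z in ?M. limsup (\<lambda>n. ereal (freq S (orbit T f (fst z) (snd z)) n)) < ereal \<alpha>"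
      using AE_space by eventually_elim (auto simp: A_def upper_freq_def not_le)
    moreover have "(\<lambda>z. freq S (orbit T f (fst z) (snd z)) n) \<in> borel_measurable ?M" for n
      by (rule measurable_compose[OF orb measurable_freq[OF S]])
    moreover have "{(\<omega>, x) \<in> space ?M. visit_freq T f S n \<omega> x \<le> \<alpha>}
        = {z \<in> space ?M. freq S (orbit T f (fst z) (snd z)) n \<le> \<alpha>}" for n
      by (auto simp: visit_freq_eq_freq)
    ultimately show False
      using not_AE_limsup_less[of "\<lambda>n z. freq S (orbit T f (fst z) (snd z)) n" \<alpha>] law by simp
  qed
  ultimately have "prob A = 1" by simp
  then have "AE z in ?M. z \<in> A" by (subst (asm) prob_eq_1) auto
  then show ?thesis by eventually_elim (simp add: A_def)
qed

lemma empirical_limits_ergodic_case: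
  assumes "ergodic_case P T f" "leaves_middle P T f"
    and close: "constants_arbitrarily_close (skew_product_law P T f)"
  shows "AE (\<omega>, x) in P \<Otimes>\<^sub>M unit_leb. empirical_limits T f \<omega> x = {dirac_mix l | l. l \<in> {0..1}}"
proof -
  have P: "prob_space P" and erg: "forward_ergodic (P \<Otimes>\<^sub>M unit_leb) (skew T f)"
    and skew: "skew T f \<in> (P \<Otimes>\<^sub>M unit_leb) \<rightarrow>\<^sub>M (P \<Otimes>\<^sub>M unit_leb)"
    using assms(1) by (auto simp: ergodic_case_def standard_probability_space_def)
  have "(1/4::real) \<in> {0<..<1/2}" by simp
  from close[unfolded constants_arbitrarily_close_def, rule_format, OF this]
  obtain \<gamma>\<^sub>0 \<gamma>\<^sub>1 where \<gamma>: "\<gamma>\<^sub>0 \<in> {0<..<1/4}" "\<gamma>\<^sub>1 \<in> {1 - 1/4<..<1}"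
    and law: "skew_product_law P T f \<gamma>\<^sub>0 \<gamma>\<^sub>1"
    by auto
  have "AE z in P \<Otimes>\<^sub>M unit_leb. 1 \<le> upper_freq {0..\<gamma>\<^sub>0} (orbit T f (fst z) (snd z))"
    by (intro AE_one_le_ereal ergodic_upper_freq P erg skew)
      (use law in \<open>auto simp: skew_product_law_def\<close>)
  moreover have "AE z in P \<Otimes>\<^sub>M unit_leb. 1 \<le> upper_freq {\<gamma>\<^sub>1..1} (orbit T f (fst z) (snd z))"
    by (intro AE_one_le_ereal ergodic_upper_freq P erg skew)
      (use law in \<open>auto simp: skew_product_law_def\<close>)
  ultimately show ?thesis
    using \<gamma> by (intro AE_empirical_limits_eq_segment[OF skew assms(2)]) auto
qed

section \<open>The one-step case\<close>

text \<open>A shift-invariant property of a sequence can be read off after any finite number of terms has been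
dropped, so it defines a tail event.\<close>

lemma trivial_tail_zero_one:
  assumes P: "prob_space P" and tail: "trivial_tail P X"
    and B: "B \<in> sets (Pi\<^sub>M UNIV (\<lambda>_. borel))"
    and shift: "\<And>s. (\<lambda>n. s (Suc n)) \<in> B \<longleftrightarrow> s \<in> B"
  shows "measure P {\<omega> \<in> space P. (\<lambda>n. X n \<omega>) \<in> B} \<in> {0, 1}"
proof -
  interpret prob_space P by fact
  let ?G = "\<lambda>n. sets (vimage_algebra (space P) (X (Suc n)) borel)"
  have shift_m: "(\<lambda>n. s (m + n)) \<in> B \<longleftrightarrow> s \<in> B" for s m
  proof (induction m)
    case (Suc m)
    then show ?case using shift[of "\<lambda>n. s (m + n)"] by simp
  qed simp
  have "{\<omega> \<in> space P. (\<lambda>n. X n \<omega>) \<in> B} \<in> sigma_sets (space P) (\<Union> (?G ` {m..}))" for m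
  proof -
    let ?N = "sigma (space P) (\<Union> (?G ` {m..}))"
    have sub: "\<Union> (?G ` {m..}) \<subseteq> Pow (space P)"
      using sets.sets_into_space by fastforce
    have "(\<lambda>\<omega> n. X (Suc m + n) \<omega>) \<in> ?N \<rightarrow>\<^sub>M Pi\<^sub>M UNIV (\<lambda>_. borel)"
    proof (rule measurable_PiM_single')
      fix n
      show "(\<lambda>\<omega>. X (Suc m + n) \<omega>) \<in> borel_measurable ?N"
      proof (rule measurableI)
        fix C :: "real set" assume "C \<in> sets borel"
        then have "X (Suc (m + n)) -` C \<inter> space P \<in> ?G (m + n)" by (rule in_vimage_algebra)
        then have "X (Suc (m + n)) -` C \<inter> space P \<in> \<Union> (?G ` {m..})" by force
        then show "X (Suc m + n) -` C \<inter> space ?N \<in> sets ?N"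
          using sub by (simp add: space_measure_of sets_measure_of sigma_sets.Basic)
      qed simp
    qed auto
    then have "(\<lambda>\<omega> n. X (Suc m + n) \<omega>) -` B \<inter> space ?N \<in> sets ?N"
      using B by (rule measurable_sets)
    moreover have "(\<lambda>\<omega> n. X (Suc m + n) \<omega>) -` B \<inter> space ?N = {\<omega> \<in> space P. (\<lambda>n. X n \<omega>) \<in> B}"
      using sub shift_m[of "\<lambda>n. X n \<omega>" "Suc m" for \<omega>] by (auto simp: space_measure_of)
    ultimately show ?thesis using sub by (simp add: sets_measure_of)
  qed
  then have "{\<omega> \<in> space P. (\<lambda>n. X n \<omega>) \<in> B} \<in> tail_events ?G"
    by (auto simp: tail_events_def)
  with tail show ?thesis unfolding trivial_tail_def by blast
qed

text \<open>Suppose that the lower set where \<open>Q\<close> holds ended at \<open>c < 1\<close>. If \<open>Q c\<close>, then \<open>c\<close> is moved up by some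
map to a larger point of the set. If not, then \<open>c\<close> is moved down by some map into the set, and
invariance pulls \<open>Q\<close> back to \<open>c\<close>.\<close>

lemma invariant_lower_set_eq_interval:
  fixes h :: "'i \<Rightarrow> real \<Rightarrow> real"
  assumes into: "\<And>i x. x \<in> {0<..<1} \<Longrightarrow> h i x \<in> {0<..<1}"
    and move: "\<And>x. x \<in> {0<..<1} \<Longrightarrow> \<exists>i j. h i x < x \<and> x < h j x"
    and inv: "\<And>i x. x \<in> {0<..<1} \<Longrightarrow> Q (h i x) \<longleftrightarrow> Q x"
    and down: "\<And>x y. 0 < x \<Longrightarrow> x \<le> y \<Longrightarrow> y < 1 \<Longrightarrow> Q y \<Longrightarrow> Q x"
    and x0: "x0 \<in> {0<..<1}" "Q x0" and x: "x \<in> {0<..<1}"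
  shows "Q x"
proof (rule ccontr)
  assume "\<not> Q x"
  define L where "L = {y \<in> {0<..<1}. Q y}"
  define c where "c = Sup L"
  have L_less: "y < x" if "y \<in> L" for y
    using that down[of x y] x \<open>\<not> Q x\<close> by (force simp: L_def)
  then have bdd: "bdd_above L" by (meson bdd_aboveI less_imp_le)
  have "x0 \<in> L" using x0 by (simp add: L_def)
  then have "x0 \<le> c" unfolding c_def using bdd by (rule cSup_upper)
  moreover have "c \<le> x" unfolding c_def using \<open>x0 \<in> L\<close> L_less
    by (intro cSup_least) (auto intro: less_imp_le)
  ultimately have c: "c \<in> {0<..<1}" using x0 x by auto
  obtain i j where ij: "h i c < c" "c < h j c" using move[OF c] by blast
  show False
  proof (cases "Q c")
    case True
    then have "h j c \<in> L" using inv[OF c] into[OF c] by (simp add: L_def)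
    then have "h j c \<le> c" unfolding c_def using bdd by (rule cSup_upper)
    with ij show False by simp
  next
    case False
    obtain y where "y \<in> L" "h i c < y"
      using ij(1) \<open>x0 \<in> L\<close> unfolding c_def by (auto dest!: less_cSupD[rotated])
    then have "Q (h i c)" using into[OF c, of i] down[of "h i c" y] by (simp add: L_def)
    with False inv[OF c] show False by simp
  qed
qed

lemma prob_space_bernoulli_measure: "prob_space (bernoulli_measure p)"
  unfolding bernoulli_measure_def by (intro prob_space_PiM prob_space_measure_pmf)

lemma space_bernoulli_measure[simp]: "space (bernoulli_measure p) = UNIV"
  by (simp add: bernoulli_measure_def space_PiM)

text \<open>Prepending an independent letter to a Bernoulli sequence gives a Bernoulli sequence, so an almost
sure property survives conditioning on any letter of positive probability.\<close>

lemma AE_bernoulli_first_letter: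
  assumes AE: "AE \<omega> in bernoulli_measure p. Q \<omega>" and "pmf p a > 0"
  shows "AE \<omega> in bernoulli_measure p. Q (case_nat a \<omega>)"
proof -
  interpret sequence_space "measure_pmf p" by unfold_locales
  interpret pair_sigma_finite "measure_pmf p" S by unfold_locales
  have "AE \<omega> in distr (measure_pmf p \<Otimes>\<^sub>M S) S (\<lambda>(s, \<omega>). case_nat s \<omega>). Q \<omega>"
    unfolding PiM_iter using AE unfolding bernoulli_measure_def .
  then have "AE z in measure_pmf p \<Otimes>\<^sub>M S. Q (case z of (s, \<omega>) \<Rightarrow> case_nat s \<omega>)"
    by (rule AE_distrD[rotated]) measurable
  from AE_pair[OF this] have "AE s in measure_pmf p. AE \<omega> in S. Q (case_nat s \<omega>)" by simp
  with \<open>pmf p a > 0\<close> show ?thesis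
    unfolding bernoulli_measure_def by (auto simp: AE_measure_pmf_iff set_pmf_iff)
qed

lemma fiber_iter_case_nat:
  "fiber_iter seq_shift (one_step g) (Suc n) (case_nat a \<omega>) x
     = fiber_iter seq_shift (one_step g) n \<omega> (g a x)"
  unfolding orbit_shift by (simp add: seq_shift_def one_step_def)

text \<open>Countability of the alphabet enters here: joint measurability of \<open>g (\<omega> 0) x\<close> in the letter and the
point follows from measurability of each map separately.\<close>

lemma measurable_skew_one_step:
  fixes p :: "'a::countable pmf"
  assumes g: "\<And>a. g a \<in> unit_borel \<rightarrow>\<^sub>M unit_borel"
  shows "skew seq_shift (one_step g)
    \<in> (bernoulli_measure p \<Otimes>\<^sub>M unit_leb) \<rightarrow>\<^sub>M (bernoulli_measure p \<Otimes>\<^sub>M unit_leb)"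
proof -
  let ?P = "bernoulli_measure p"
  have sets_eq: "sets unit_leb = sets unit_borel" by (simp add: sets_restrict_space)
  have [measurable]: "g a \<in> unit_leb \<rightarrow>\<^sub>M unit_leb" for a
    using g unfolding measurable_cong_sets[OF sets_eq sets_eq] .
  have letter: "(\<lambda>\<omega>. \<omega> n) \<in> ?P \<rightarrow>\<^sub>M count_space UNIV" for n
    unfolding bernoulli_measure_def by measurable
  then have "(\<lambda>z. fst z 0) \<in> (?P \<Otimes>\<^sub>M unit_leb) \<rightarrow>\<^sub>M count_space UNIV"
    by (rule measurable_compose[OF measurable_fst])
  then have "(\<lambda>z. g (fst z 0) (snd z)) \<in> (?P \<Otimes>\<^sub>M unit_leb) \<rightarrow>\<^sub>M unit_leb"
    by (rule measurable_compose_countable[rotated]) measurable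
  moreover have "seq_shift \<in> ?P \<rightarrow>\<^sub>M ?P"
    unfolding seq_shift_def
    by (subst (2) bernoulli_measure_def, rule measurable_PiM_single') (auto intro: letter)
  ultimately show ?thesis
    unfolding skew_def split_beta' one_step_def
    by (intro measurable_Pair measurable_compose[OF measurable_fst])
qed

context
  fixes p :: "'a::countable pmf" and g :: "'a \<Rightarrow> real \<Rightarrow> real"
  assumes one_step: "one_step_case p g"
begin

private abbreviation "orb \<equiv> \<lambda>\<omega> x. orbit seq_shift (one_step g) \<omega> x"

interpretation P: prob_space "bernoulli_measure p" by (rule prob_space_bernoulli_measure)

lemma one_step_into: "x \<in> {0<..<1} \<Longrightarrow> g a x \<in> {0<..<1}"
proof -
  have "one_step g (\<lambda>_. a) \<in> {0<..<1} \<rightarrow> {0<..<1}"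
    using one_step unfolding one_step_case_def by blast
  then show "x \<in> {0<..<1} \<Longrightarrow> g a x \<in> {0<..<1}" by (auto simp: one_step_def)
qed

lemma one_step_mono:
  "x \<in> {0<..<1} \<Longrightarrow> y \<in> {0<..<1} \<Longrightarrow> x \<le> y \<Longrightarrow> one_step g \<omega> x \<le> one_step g \<omega> y"
proof -
  have "mono_on {0<..<1} (one_step g \<omega>)"
    using one_step unfolding one_step_case_def by blast
  then show "x \<in> {0<..<1} \<Longrightarrow> y \<in> {0<..<1} \<Longrightarrow> x \<le> y \<Longrightarrow> one_step g \<omega> x \<le> one_step g \<omega> y"
    by (rule mono_onD)
qed

lemma orbit_interior: "x \<in> {0<..<1} \<Longrightarrow> orb \<omega> x n \<in> {0<..<1}"
proof (induction n)
  case (Suc n)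
  then show ?case by (simp only: fiber_iter.simps one_step_def one_step_into)
qed simp

lemma orbit_mono:
  assumes "x \<in> {0<..<1}" "y \<in> {0<..<1}" "x \<le> y"
  shows "orb \<omega> x n \<le> orb \<omega> y n"
proof (induction n)
  case (Suc n)
  show ?case
    unfolding fiber_iter.simps
    by (rule one_step_mono[OF orbit_interior orbit_interior Suc.IH]) (use assms in auto)
qed (use assms in simp)

lemma measurable_skew: "skew seq_shift (one_step g)
    \<in> (bernoulli_measure p \<Otimes>\<^sub>M unit_leb) \<rightarrow>\<^sub>M (bernoulli_measure p \<Otimes>\<^sub>M unit_leb)"
proof (rule measurable_skew_one_step)
  show "g a \<in> unit_borel \<rightarrow>\<^sub>M unit_borel" for a
    using one_step unfolding one_step_case_def by blast
qed

lemma measurable_orbit_one_step: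
  assumes "x \<in> {0<..<1}"
  shows "(\<lambda>\<omega>. orb \<omega> x) \<in> bernoulli_measure p \<rightarrow>\<^sub>M Pi\<^sub>M UNIV (\<lambda>_. borel)"
proof -
  from measurable_compose[OF measurable_Pair2' measurable_orbit[OF measurable_skew], of x] show ?thesis
    using assms by simp
qed

lemma upper_freq_zero_one:
  assumes x: "x \<in> {0<..<1}" and S: "S \<in> sets borel"
  shows "(AE \<omega> in bernoulli_measure p. b \<le> upper_freq S (orb \<omega> x)) \<or>
    (AE \<omega> in bernoulli_measure p. \<not> b \<le> upper_freq S (orb \<omega> x))"
proof -
  let ?B = "{s. b \<le> upper_freq S s}"
  have "{s \<in> space (Pi\<^sub>M UNIV (\<lambda>_. borel)). b \<le> upper_freq S s} \<in> sets (Pi\<^sub>M UNIV (\<lambda>_. borel))"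
    using measurable_upper_freq[OF S] by measurable
  then have B: "?B \<in> sets (Pi\<^sub>M UNIV (\<lambda>_. borel))" by (simp add: space_PiM)
  let ?A = "{\<omega> \<in> space (bernoulli_measure p). orb \<omega> x \<in> ?B}"
  have "P.prob ?A \<in> {0, 1}"
  proof (rule trivial_tail_zero_one[OF P.prob_space_axioms _ B])
    show "trivial_tail (bernoulli_measure p) (\<lambda>n \<omega>. orb \<omega> x n)"
      using one_step x unfolding one_step_case_def by blast
  qed (simp add: upper_freq_shift)
  moreover have "?A \<in> P.events"
    using measurable_sets[OF measurable_orbit_one_step[OF x] B] by (simp add: vimage_def)
  ultimately have "(AE \<omega> in bernoulli_measure p. \<omega> \<in> ?A) \<or> (AE \<omega> in bernoulli_measure p. \<omega> \<notin> ?A)"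
    by (auto simp: P.prob_eq_0 P.prob_eq_1)
  then show ?thesis by auto
qed

text \<open>The probability of a tail event is the weighted mean, over the first letter \<open>a\<close>, of its
probabilities for the orbits of \<open>g a x\<close>. Being \<open>0\<close> or \<open>1\<close>, it must agree with each of them.\<close>

lemma AE_upper_freq_step_iff:
  assumes x: "x \<in> {0<..<1}" and S: "S \<in> sets borel"
  shows "(AE \<omega> in bernoulli_measure p. b \<le> upper_freq S (orb \<omega> (g a x))) \<longleftrightarrow>
    (AE \<omega> in bernoulli_measure p. b \<le> upper_freq S (orb \<omega> x))"
proof -
  have "pmf p a > 0" using one_step unfolding one_step_case_def by blast
  have eq: "upper_freq S (orb (case_nat a \<omega>) x) = upper_freq S (orb \<omega> (g a x))" for \<omega>
    by (subst upper_freq_shift[symmetric]) (simp only: fiber_iter_case_nat)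
  note step = AE_bernoulli_first_letter[OF _ \<open>pmf p a > 0\<close>,
      where Q = "\<lambda>\<omega>. R (upper_freq S (orb \<omega> x))" for R, unfolded eq]
  show ?thesis
  proof
    assume *: "AE \<omega> in bernoulli_measure p. b \<le> upper_freq S (orb \<omega> (g a x))"
    show "AE \<omega> in bernoulli_measure p. b \<le> upper_freq S (orb \<omega> x)"
    proof (rule ccontr)
      assume "\<not> ?thesis"
      then have "AE \<omega> in bernoulli_measure p. \<not> b \<le> upper_freq S (orb \<omega> x)"
        using upper_freq_zero_one[OF x S] by blast
      from step[OF this] * have "AE \<omega> in bernoulli_measure p. False" by eventually_elim simp
      then show False by simp
    qed
  qed (rule step)
qed

lemma AE_upper_freq_of_law:
  assumes x: "x \<in> {0<..<1}" and S: "S \<in> sets borel"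
    and law: "liminf (\<lambda>n. emeasure (bernoulli_measure p)
      {\<omega> \<in> space (bernoulli_measure p). visit_freq seq_shift (one_step g) S n \<omega> x \<le> \<alpha>}) < 1"
  shows "AE \<omega> in bernoulli_measure p. ereal \<alpha> \<le> upper_freq S (orb \<omega> x)"
proof -
  have "\<not> (AE \<omega> in bernoulli_measure p. limsup (\<lambda>n. ereal (freq S (orb \<omega> x) n)) < ereal \<alpha>)"
    using law measurable_compose[OF measurable_orbit_one_step[OF x] measurable_freq[OF S]]
    by (intro P.not_AE_limsup_less) (simp_all add: visit_freq_eq_freq)
  then show ?thesis
    using upper_freq_zero_one[OF x S, of "ereal \<alpha>"] by (simp add: upper_freq_def not_le)
qed

lemma one_step_moves: "x \<in> {0<..<1} \<Longrightarrow> \<exists>i j. g i x < x \<and> x < g j x"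
proof -
  assume "x \<in> {0<..<1}"
  then obtain \<alpha> \<beta> where "one_step g \<alpha> x < x \<and> x < one_step g \<beta> x"
    using one_step unfolding one_step_case_def by metis
  then show ?thesis by (auto simp: one_step_def)
qed

text \<open>Since the maps are increasing, orbits of smaller points visit neighbourhoods of \<open>0\<close> more often; the
points whose upper frequency is almost surely large thus form an invariant lower set.\<close>

lemma AE_upper_freq_lower:
  assumes y: "y \<in> {0<..<1}" "AE \<omega> in bernoulli_measure p. b \<le> upper_freq {0..\<gamma>} (orb \<omega> y)"
    and x: "x \<in> {0<..<1}"
  shows "AE \<omega> in bernoulli_measure p. b \<le> upper_freq {0..\<gamma>} (orb \<omega> x)"
proof -
  define Q where "Q u \<longleftrightarrow> (AE \<omega> in bernoulli_measure p. b \<le> upper_freq {0..\<gamma>} (orb \<omega> u))" for u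
  have inv: "Q (g a u) \<longleftrightarrow> Q u" if "u \<in> {0<..<1}" for a u
    unfolding Q_def using that by (rule AE_upper_freq_step_iff) simp
  have down: "Q u" if uv: "0 < u" "u \<le> v" "v < 1" and "Q v" for u v
  proof -
    have le: "upper_freq {0..\<gamma>} (orb \<omega> v) \<le> upper_freq {0..\<gamma>} (orb \<omega> u)" for \<omega>
    proof (rule upper_freq_mono)
      fix j assume "orb \<omega> v j \<in> {0..\<gamma>}"
      then show "orb \<omega> u j \<in> {0..\<gamma>}"
        using orbit_mono[of u v j \<omega>] orbit_interior[of u j \<omega>] uv by auto
    qed
    show "Q u"
      using \<open>Q v\<close> unfolding Q_def by eventually_elim (rule order_trans[OF _ le])
  qed
  have "Q y" using y(2) by (simp only: Q_def)
  have "Q x"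
    by (rule invariant_lower_set_eq_interval[of g Q y x])
      (fact one_step_into one_step_moves inv down y(1) \<open>Q y\<close> x)+
  then show ?thesis by (simp only: Q_def)
qed

text \<open>Near \<open>1\<close> the good points form an upper set, so here the argument is applied to its complement: one
bad point would make every point bad.\<close>

lemma AE_upper_freq_upper:
  assumes y: "y \<in> {0<..<1}" "AE \<omega> in bernoulli_measure p. b \<le> upper_freq {\<gamma>..1} (orb \<omega> y)"
    and x: "x \<in> {0<..<1}"
  shows "AE \<omega> in bernoulli_measure p. b \<le> upper_freq {\<gamma>..1} (orb \<omega> x)"
proof (rule ccontr)
  define Q where "Q u \<longleftrightarrow> \<not> (AE \<omega> in bernoulli_measure p. b \<le> upper_freq {\<gamma>..1} (orb \<omega> u))" for u
  assume "\<not> ?thesis"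
  then have "Q x" by (simp only: Q_def not_False_eq_True)
  have inv: "Q (g a u) \<longleftrightarrow> Q u" if "u \<in> {0<..<1}" for a u
    unfolding Q_def using AE_upper_freq_step_iff[OF that, of "{\<gamma>..1}" b a] by simp
  have down: "Q u" if uv: "0 < u" "u \<le> v" "v < 1" and "Q v" for u v
    unfolding Q_def
  proof
    have le: "upper_freq {\<gamma>..1} (orb \<omega> u) \<le> upper_freq {\<gamma>..1} (orb \<omega> v)" for \<omega>
    proof (rule upper_freq_mono)
      fix j assume "orb \<omega> u j \<in> {\<gamma>..1}"
      then show "orb \<omega> v j \<in> {\<gamma>..1}"
        using orbit_mono[of u v j \<omega>] orbit_interior[of v j \<omega>] uv by auto
    qed
    assume "AE \<omega> in bernoulli_measure p. b \<le> upper_freq {\<gamma>..1} (orb \<omega> u)"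
    then have "AE \<omega> in bernoulli_measure p. b \<le> upper_freq {\<gamma>..1} (orb \<omega> v)"
      by eventually_elim (rule order_trans[OF _ le])
    with \<open>Q v\<close> show False unfolding Q_def ..
  qed
  have "Q y"
    by (rule invariant_lower_set_eq_interval[of g Q x y])
      (fact one_step_into one_step_moves inv down y(1) \<open>Q x\<close> x)+
  with y(2) show False unfolding Q_def by simp
qed

lemma AE_product_upper_freq:
  assumes S: "S \<in> sets borel"
    and all: "\<And>x. x \<in> {0<..<1} \<Longrightarrow> AE \<omega> in bernoulli_measure p. b \<le> upper_freq S (orb \<omega> x)"
  shows "AE z in bernoulli_measure p \<Otimes>\<^sub>M unit_leb. b \<le> upper_freq S (orb (fst z) (snd z))"
proof -
  interpret L: prob_space unit_leb by (rule prob_space_unit_leb)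
  interpret pair_sigma_finite "bernoulli_measure p" unit_leb by unfold_locales
  have meas: "(\<lambda>z. upper_freq S (orb (fst z) (snd z))) \<in> borel_measurable (bernoulli_measure p \<Otimes>\<^sub>M unit_leb)"
    by (rule measurable_compose[OF measurable_orbit[OF measurable_skew] measurable_upper_freq[OF S]])
  have set: "{z \<in> space (bernoulli_measure p \<Otimes>\<^sub>M unit_leb). b \<le> upper_freq S (orb (fst z) (snd z))}
      \<in> sets (bernoulli_measure p \<Otimes>\<^sub>M unit_leb)"
    using meas by measurable
  have "AE x in lborel. x \<noteq> (0::real)" "AE x in lborel. x \<noteq> (1::real)"
    by (rule AE_lborel_singleton)+
  then have "AE x in lborel. x \<in> {0..1} \<longrightarrow> x \<in> {0<..<1::real}"
    by eventually_elim auto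
  then have "AE x in unit_leb. x \<in> {0<..<1}" by (subst AE_restrict_space_iff, simp, assumption)
  then have "AE x in unit_leb. AE \<omega> in bernoulli_measure p. b \<le> upper_freq S (orb \<omega> x)"
    by eventually_elim (rule all)
  then have "AE \<omega> in bernoulli_measure p. AE x in unit_leb. b \<le> upper_freq S (orb \<omega> x)"
    using AE_commute[of "\<lambda>\<omega> x. b \<le> upper_freq S (orb \<omega> x)", OF set] by simp
  then show ?thesis by (intro AE_pair_measure[OF set]) simp
qed

lemma empirical_limits_one_step_case:
  assumes mid: "leaves_middle (bernoulli_measure p) seq_shift (one_step g)"
    and close: "constants_arbitrarily_close
      (pointwise_fiber_law (bernoulli_measure p) seq_shift (one_step g))"
  shows "AE (\<omega>, x) in bernoulli_measure p \<Otimes>\<^sub>M unit_leb.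
    empirical_limits seq_shift (one_step g) \<omega> x = {dirac_mix l | l. l \<in> {0..1}}"
proof -
  have "(1/4::real) \<in> {0<..<1/2}" by simp
  from close[unfolded constants_arbitrarily_close_def, rule_format, OF this]
  obtain \<gamma>\<^sub>0 \<gamma>\<^sub>1 where \<gamma>: "\<gamma>\<^sub>0 \<in> {0<..<1/4}" "\<gamma>\<^sub>1 \<in> {1 - 1/4<..<1}"
    and law: "pointwise_fiber_law (bernoulli_measure p) seq_shift (one_step g) \<gamma>\<^sub>0 \<gamma>\<^sub>1"
    by auto
  from law obtain x\<^sub>0 x\<^sub>1 where x0: "x\<^sub>0 \<in> {0<..<1}" and x1: "x\<^sub>1 \<in> {0<..<1}"
    and fluct: "\<forall>\<alpha>\<in>{0<..<1}.
      liminf (\<lambda>n. emeasure (bernoulli_measure p) {\<omega> \<in> space (bernoulli_measure p).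
        visit_freq seq_shift (one_step g) {0..\<gamma>\<^sub>0} n \<omega> x\<^sub>0 \<le> \<alpha>}) < 1 \<and>
      liminf (\<lambda>n. emeasure (bernoulli_measure p) {\<omega> \<in> space (bernoulli_measure p).
        visit_freq seq_shift (one_step g) {\<gamma>\<^sub>1..1} n \<omega> x\<^sub>1 \<le> \<alpha>}) < 1"
    unfolding pointwise_fiber_law_def by (elim conjE bexE) (rule that)
  have "AE z in bernoulli_measure p \<Otimes>\<^sub>M unit_leb. 1 \<le> upper_freq {0..\<gamma>\<^sub>0} (orb (fst z) (snd z))"
  proof (intro AE_one_le_ereal AE_product_upper_freq)
    fix \<alpha> x :: real assume "0 < \<alpha>" "\<alpha> < 1" "x \<in> {0<..<1}"
    with fluct have "AE \<omega> in bernoulli_measure p. ereal \<alpha> \<le> upper_freq {0..\<gamma>\<^sub>0} (orb \<omega> x\<^sub>0)"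
      by (intro AE_upper_freq_of_law[OF x0]) simp_all
    then show "AE \<omega> in bernoulli_measure p. ereal \<alpha> \<le> upper_freq {0..\<gamma>\<^sub>0} (orb \<omega> x)"
      using \<open>x \<in> _\<close> by (rule AE_upper_freq_lower[OF x0])
  qed simp
  moreover have "AE z in bernoulli_measure p \<Otimes>\<^sub>M unit_leb. 1 \<le> upper_freq {\<gamma>\<^sub>1..1} (orb (fst z) (snd z))"
  proof (intro AE_one_le_ereal AE_product_upper_freq)
    fix \<alpha> x :: real assume "0 < \<alpha>" "\<alpha> < 1" "x \<in> {0<..<1}"
    with fluct have "AE \<omega> in bernoulli_measure p. ereal \<alpha> \<le> upper_freq {\<gamma>\<^sub>1..1} (orb \<omega> x\<^sub>1)"
      by (intro AE_upper_freq_of_law[OF x1]) simp_all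
    then show "AE \<omega> in bernoulli_measure p. ereal \<alpha> \<le> upper_freq {\<gamma>\<^sub>1..1} (orb \<omega> x)"
      using \<open>x \<in> _\<close> by (rule AE_upper_freq_upper[OF x1])
  qed simp
  ultimately show ?thesis
    using \<gamma> by (intro AE_empirical_limits_eq_segment[OF measurable_skew mid]) auto
qed

end

section \<open>Both cases together\<close>

theorem proposition2:
  fixes p :: "'a::countable pmf" and g :: "'a \<Rightarrow> real \<Rightarrow> real"
    and P :: "'w measure" and T :: "'w \<Rightarrow> 'w" and f :: "'w \<Rightarrow> real \<Rightarrow> real"
  shows
    "(one_step_case p g \<and>
      fixes_endpoints (bernoulli_measure p) (one_step g) \<and>
      leaves_middle (bernoulli_measure p) seq_shift (one_step g) \<and>
      constants_arbitrarily_close (pointwise_fiber_law (bernoulli_measure p) seq_shift (one_step g))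
      \<longrightarrow> (AE (\<omega>, x) in bernoulli_measure p \<Otimes>\<^sub>M unit_leb.
            empirical_limits seq_shift (one_step g) \<omega> x = {dirac_mix l | l. l \<in> {0..1}}))
     \<and>
     (ergodic_case P T f \<and>
      fixes_endpoints P f \<and>
      leaves_middle P T f \<and>
      constants_arbitrarily_close (skew_product_law P T f)
      \<longrightarrow> (AE (\<omega>, x) in P \<Otimes>\<^sub>M unit_leb.
            empirical_limits T f \<omega> x = {dirac_mix l | l. l \<in> {0..1}}))"
  by (intro conjI impI; elim conjE;
      rule empirical_limits_one_step_case empirical_limits_ergodic_case; assumption)

end
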